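(* Let $X$ be a Hilbert $C^*$-module over a $C^*$-algebra $B$ and let $M,N\subset X$ be complemented submodules. Then the (cosine of the) Friedrichs angle $c(M,N)$ is well-defined (that is, $c_\pi(M,N)$ has the same value for every faithful representation $\pi$ of $B$), and $c(M,N)=c(M^\perp,N^\perp)$.
   Context: A closed submodule $\Omega\subset X$ is complemented if $X=\Omega\oplus\Omega^\perp$, where $\Omega^\perp=\{x\in X:\langle x,y\rangle=0\ \forall y\in\Omega\}$. For a representation $\pi:B\to\mathbb{B}(H_\pi)$ on a Hilbert space, $X_\pi:=X\otimes_B H_\pi$ is the Hilbert space given by the interior tensor product, and for a closed submodule $\Omega\subset X$, $\Omega_\pi:=\Omega\otimes_B H_\pi$ is regarded as a closed subspace of $X_\pi$ (the closed linear span of $\{x\otimes h:x\in\Omega,h\in H_\pi\}$). For complemented submodules $M,N\subset X$, the (cosine of the) local Friedrichs angle at $\pi$ is $c_\pi(M,N):=\|P_{M_\pi}P_{N_\pi}-P_{M_\pi\cap N_\pi}\|$, where $P_V\in\mathbb{B}(X_\pi)$ denotes the orthogonal projection onto a closed subspace $V$ of the Hilbert space $X_\pi$. The (cosine of the) Friedrichs angle of an arbitrary pair of complemented submodules is defined as $c(M,N):=c_\pi(M,N)$ for any faithful representation $\pi$ of $B$. No complementability of $M\cap N$ or $M^\perp\cap N^\perp$ is assumed. *)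

theory Defs
  imports "HOL-Analysis.Analysis"
begin

class complex_vector = real_vector +
  fixes scaleC :: "complex \<Rightarrow> 'a \<Rightarrow> 'a"  (infixr "*\<^sub>C" 75)
  assumes scaleC_add_right: "c *\<^sub>C (x + y) = c *\<^sub>C x + c *\<^sub>C y"
    and scaleC_add_left: "(c + d) *\<^sub>C x = c *\<^sub>C x + d *\<^sub>C x"
    and scaleC_scaleC: "c *\<^sub>C (d *\<^sub>C x) = (c * d) *\<^sub>C x"
    and scaleC_one: "1 *\<^sub>C x = x"
    and scaleR_scaleC: "r *\<^sub>R x = complex_of_real r *\<^sub>C x"

global_interpretation complex_vector:
  vector_space "scaleC :: complex \<Rightarrow> 'a \<Rightarrow> 'a::complex_vector"
  by unfold_locales (simp_all add: scaleC_add_right scaleC_add_left scaleC_scaleC scaleC_one)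

class complex_normed_vector = complex_vector + real_normed_vector +
  assumes norm_scaleC: "norm (c *\<^sub>C x) = cmod c * norm x"

class complex_banach = complex_normed_vector + banach

text \<open>Inner products are conjugate-linear in the first and linear in the second argument.
  Since \<^class>\<open>real_inner\<close> ties the norm to \<^const>\<open>inner\<close>, the last axiom below makes
  the norm the one induced by \<open>cinner\<close>.\<close>

class complex_hilbert = complex_banach + real_inner +
  fixes cinner :: "'a \<Rightarrow> 'a \<Rightarrow> complex"
  assumes cinner_commute: "cinner x y = cnj (cinner y x)"
    and cinner_add_right: "cinner x (y + z) = cinner x y + cinner x z"
    and cinner_scaleC_right: "cinner x (c *\<^sub>C y) = c * cinner x y"
    and Re_cinner: "Re (cinner x y) = inner x y"

text \<open>Not necessarily unital; submultiplicativity of the norm is part of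
  \<^class>\<open>real_normed_algebra\<close>.\<close>

class cstar_algebra = complex_banach + real_normed_algebra +
  fixes adj :: "'a \<Rightarrow> 'a"
  assumes scaleC_mult_left: "(c *\<^sub>C a) * b = c *\<^sub>C (a * b)"
    and scaleC_mult_right: "a * (c *\<^sub>C b) = c *\<^sub>C (a * b)"
    and adj_adj: "adj (adj a) = a"
    and adj_add: "adj (a + b) = adj a + adj b"
    and adj_scaleC: "adj (c *\<^sub>C a) = cnj c *\<^sub>C adj a"
    and adj_mult: "adj (a * b) = adj b * adj a"
    and cstar_identity: "norm (adj a * a) = (norm a)\<^sup>2"

definition positive_element :: "'b::cstar_algebra \<Rightarrow> bool" where
  "positive_element a \<longleftrightarrow> (\<exists>b. a = adj b * b)"

text \<open>A right Hilbert module: \<open>act x b\<close> is $xb$ and \<open>ip x y\<close> is the algebra-valued inner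
  product of \<open>x\<close> and \<open>y\<close>. The type class makes the module complete, and the last axiom makes
  its norm the one induced by \<open>ip\<close> (so that \<open>ip\<close> is definite).\<close>

locale hilbert_module =
  fixes act :: "'x::complex_banach \<Rightarrow> 'b::cstar_algebra \<Rightarrow> 'x"
    and ip :: "'x \<Rightarrow> 'x \<Rightarrow> 'b"
  assumes act_add_left: "act (x + y) b = act x b + act y b"
    and act_add_right: "act x (a + b) = act x a + act x b"
    and act_mult: "act x (a * b) = act (act x a) b"
    and act_scaleC_left: "act (c *\<^sub>C x) b = c *\<^sub>C act x b"
    and act_scaleC_right: "act x (c *\<^sub>C b) = c *\<^sub>C act x b"
    and ip_add_right: "ip x (y + z) = ip x y + ip x z"
    and ip_scaleC_right: "ip x (c *\<^sub>C y) = c *\<^sub>C ip x y"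
    and ip_act_right: "ip x (act y b) = ip x y * b"
    and ip_adj: "adj (ip x y) = ip y x"
    and ip_positive: "positive_element (ip x x)"
    and norm_ip: "norm x = sqrt (norm (ip x x))"

definition module_perp :: "('x \<Rightarrow> 'x \<Rightarrow> 'b::zero) \<Rightarrow> 'x set \<Rightarrow> 'x set" where
  "module_perp ip M = {x. \<forall>y\<in>M. ip x y = 0}"

definition closed_submodule ::
    "('x::complex_normed_vector \<Rightarrow> 'b \<Rightarrow> 'x) \<Rightarrow> 'x set \<Rightarrow> bool" where
  "closed_submodule act M \<longleftrightarrow>
     complex_vector.subspace M \<and> (\<forall>x\<in>M. \<forall>b. act x b \<in> M) \<and> closed M"

definition complemented_submodule ::
    "('x::complex_normed_vector \<Rightarrow> 'b::zero \<Rightarrow> 'x) \<Rightarrow> ('x \<Rightarrow> 'x \<Rightarrow> 'b) \<Rightarrow> 'x set \<Rightarrow> bool" where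
  "complemented_submodule act ip M \<longleftrightarrow>
     closed_submodule act M \<and> M \<inter> module_perp ip M = {0} \<and>
     (\<forall>x. \<exists>y\<in>M. \<exists>z\<in>module_perp ip M. x = y + z)"

text \<open>Representations by bounded operators; they are allowed to be degenerate.\<close>

definition representation :: "('b::cstar_algebra \<Rightarrow> 'h::complex_hilbert \<Rightarrow> 'h) \<Rightarrow> bool" where
  "representation \<pi> \<longleftrightarrow>
     (\<forall>a. bounded_linear (\<pi> a)) \<and>
     (\<forall>a c h. \<pi> a (c *\<^sub>C h) = c *\<^sub>C \<pi> a h) \<and>
     (\<forall>a b h. \<pi> (a + b) h = \<pi> a h + \<pi> b h) \<and>
     (\<forall>c a h. \<pi> (c *\<^sub>C a) h = c *\<^sub>C \<pi> a h) \<and>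
     (\<forall>a b h. \<pi> (a * b) h = \<pi> a (\<pi> b h)) \<and>
     (\<forall>a h k. cinner (\<pi> (adj a) h) k = cinner h (\<pi> a k))"

definition faithful_representation ::
    "('b::cstar_algebra \<Rightarrow> 'h::complex_hilbert \<Rightarrow> 'h) \<Rightarrow> bool" where
  "faithful_representation \<pi> \<longleftrightarrow> representation \<pi> \<and> inj \<pi>"

text \<open>The Hilbert space $X \otimes_B H$ is the completion of the algebraic tensor product
  $X \odot_B H$, modulo null vectors, for the semi-inner product
  $\langle x \otimes h, y \otimes k\rangle = \langle h, \pi(\langle x, y\rangle) k\rangle$.
  As it depends on the value \<open>\<pi>\<close>, it cannot be a type constructor. Instead, the predicate below
  says that the Hilbert space \<open>'k\<close> together with $\tau(x, h) = x \otimes h$ is such a completion: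
  $\tau$ is bilinear and balanced (hence defined on $X \odot_B H$), it carries the semi-inner product
  to the inner product of \<open>'k\<close>, and its range spans a dense subspace. This determines the pair up to
  a unique unitary.\<close>

definition interior_tensor_product ::
    "('x::complex_banach \<Rightarrow> 'b::cstar_algebra \<Rightarrow> 'x) \<Rightarrow> ('x \<Rightarrow> 'x \<Rightarrow> 'b) \<Rightarrow>
     ('b \<Rightarrow> 'h::complex_hilbert \<Rightarrow> 'h) \<Rightarrow> ('x \<Rightarrow> 'h \<Rightarrow> 'k::complex_hilbert) \<Rightarrow> bool" where
  "interior_tensor_product act ip \<pi> \<tau> \<longleftrightarrow>
     (\<forall>x y h. \<tau> (x + y) h = \<tau> x h + \<tau> y h) \<and>
     (\<forall>x h k. \<tau> x (h + k) = \<tau> x h + \<tau> x k) \<and>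
     (\<forall>c x h. \<tau> (c *\<^sub>C x) h = c *\<^sub>C \<tau> x h) \<and>
     (\<forall>c x h. \<tau> x (c *\<^sub>C h) = c *\<^sub>C \<tau> x h) \<and>
     (\<forall>x b h. \<tau> (act x b) h = \<tau> x (\<pi> b h)) \<and>
     (\<forall>x h y k. cinner (\<tau> x h) (\<tau> y k) = cinner h (\<pi> (ip x y) k)) \<and>
     closure (complex_vector.span {\<tau> x h | x h. True}) = UNIV"

definition localized_submodule ::
    "('x \<Rightarrow> 'h \<Rightarrow> 'k::complex_hilbert) \<Rightarrow> 'x set \<Rightarrow> 'k set" where
  "localized_submodule \<tau> M = closure (complex_vector.span {\<tau> x h | x h. x \<in> M})"

definition orth_proj :: "'k::complex_hilbert set \<Rightarrow> 'k \<Rightarrow> 'k" where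
  "orth_proj V z = (THE p. p \<in> V \<and> (\<forall>v\<in>V. cinner v (z - p) = 0))"

text \<open>The cosine $c_\pi(M, N)$ of the local Friedrichs angle, computed in the interior tensor
  product given by \<open>\<tau>\<close>.\<close>

definition local_friedrichs_cos ::
    "('x \<Rightarrow> 'h \<Rightarrow> 'k::complex_hilbert) \<Rightarrow> 'x set \<Rightarrow> 'x set \<Rightarrow> real" where
  "local_friedrichs_cos \<tau> M N =
     onorm (\<lambda>z.
       orth_proj (localized_submodule \<tau> M) (orth_proj (localized_submodule \<tau> N) z) -
       orth_proj (localized_submodule \<tau> M \<inter> localized_submodule \<tau> N) z)"

end

theory Submission
  imports Defs
begin

text \<open>Let \<open>P\<close>, \<open>Q\<close> be the projections onto closed subspaces \<open>V\<close>, \<open>W\<close> of a Hilbert space and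
  \<open>A = Q P Q\<close>.  The cosine of the angle is at most \<open>s\<close> iff \<open>\<parallel>P w\<parallel> \<le> s \<parallel>w\<parallel>\<close> for all \<open>w \<in> W\<close>
  orthogonal to \<open>V \<inter> W\<close>, and, since the range of \<open>1 - A\<close> is dense in the complement of
  \<open>V \<inter> W\<close>, iff \<open>(1 - A)(s\<^sup>2 - A)(1 - A) \<ge> 0\<close>.  The first criterion passes to orthogonal complements.

  In the localization, the operator of the second criterion is \<open>T \<otimes> 1\<close> for an adjointable
  operator \<open>T\<close> on the module. The absolute value \<open>\<bar>T\<bar>\<close> exists on the module, as a norm limit of
  polynomials in \<open>T\<close>. If \<open>T \<otimes> 1 \<ge> 0\<close> then \<open>T\<close> and \<open>\<bar>T\<bar>\<close> have the same localization, so faithfulness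
  forces \<open>T = \<bar>T\<bar>\<close>, and this makes \<open>T \<otimes> 1\<close> nonnegative in every other localization.\<close>

section \<open>Orthogonal projections in a complex Hilbert space\<close>

lemma complete_subspace_projection:
  fixes S :: "'a::{real_inner,complete_space} set"
  assumes "subspace S" "closed S"
  shows "\<exists>p\<in>S. \<forall>v\<in>S. inner v (z - p) = 0"
proof -
  define d where "d = (INF v\<in>S. (norm (z - v))\<^sup>2)"
  have ne: "S \<noteq> {}" using assms(1) subspace_0 by auto
  have bdd: "bdd_below ((\<lambda>v. (norm (z - v))\<^sup>2) ` S)" by (rule bdd_belowI[of _ 0]) auto
  have dle: "d \<le> (norm (z - v))\<^sup>2" if "v \<in> S" for v
    unfolding d_def using that by (intro cINF_lower bdd)
  have "\<exists>v\<in>S. (norm (z - v))\<^sup>2 < d + 1 / Suc n" for n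
    using cINF_less_iff[OF ne bdd, of "d + 1 / Suc n"] unfolding d_def by auto
  then obtain f where fS: "\<And>n. f n \<in> S" and f: "\<And>n. (norm (z - f n))\<^sup>2 < d + 1 / Suc n"
    by metis
  \<comment> \<open>The midpoint of two members of the sequence lies in \<open>S\<close>, so its
    distance to \<open>z\<close> is bounded below by \<open>d\<close>.\<close>
  have dist2: "(norm (f m - f n))\<^sup>2 \<le> 2 / Suc m + 2 / Suc n" for m n
  proof -
    have "(1/2) *\<^sub>R (f m + f n) \<in> S"
      using assms(1) fS by (simp add: subspace_add subspace_scale)
    from dle[OF this] have "4 * d \<le> 4 * (norm (z - (1/2) *\<^sub>R (f m + f n)))\<^sup>2" by simp
    also have "\<dots> = 2 * (norm (z - f m))\<^sup>2 + 2 * (norm (z - f n))\<^sup>2 - (norm (f m - f n))\<^sup>2"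
      unfolding power2_norm_eq_inner
      by (simp add: inner_diff_left inner_diff_right inner_add_left inner_add_right inner_commute algebra_simps)
    finally show ?thesis using f[of m] f[of n] by simp
  qed
  have "Cauchy f"
  proof (rule CauchyI)
    fix e :: real assume "0 < e"
    then obtain k where k: "4 / e\<^sup>2 < real k" using reals_Archimedean2 by blast
    have "norm (f m - f n) < e" if "m \<ge> k" "n \<ge> k" for m n
    proof -
      have "2 / Suc m \<le> 2 / Suc k" "2 / Suc n \<le> 2 / Suc k"
        using that by (auto intro!: divide_left_mono)
      then have "(norm (f m - f n))\<^sup>2 \<le> 4 / Suc k" using dist2[of m n] by simp
      also have "\<dots> < e\<^sup>2"
      proof -
        have "4 < real k * e\<^sup>2" using k \<open>0 < e\<close> by (simp add: divide_less_eq)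
        also have "\<dots> \<le> real (Suc k) * e\<^sup>2" by (intro mult_right_mono) auto
        finally have "4 < real (Suc k) * e\<^sup>2" .
        then show ?thesis by (simp add: divide_less_eq mult.commute)
      qed
      finally show ?thesis using \<open>0 < e\<close> by (simp add: power_less_imp_less_base)
    qed
    then show "\<exists>M. \<forall>m\<ge>M. \<forall>n\<ge>M. norm (f m - f n) < e" by blast
  qed
  then obtain p where p: "f \<longlonglongrightarrow> p" using Cauchy_convergent_iff convergent_def by blast
  have pS: "p \<in> S" using closed_sequentially[OF assms(2)] fS p by blast
  have pd: "(norm (z - p))\<^sup>2 \<le> d"
  proof (rule LIMSEQ_le)
    show "(\<lambda>n. (norm (z - f n))\<^sup>2) \<longlonglongrightarrow> (norm (z - p))\<^sup>2" by (intro tendsto_intros p)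
    have "(\<lambda>n. 1 / real (Suc n)) \<longlonglongrightarrow> 0" using LIMSEQ_inverse_real_of_nat by (simp add: inverse_eq_divide)
    from tendsto_add[OF tendsto_const this, of d]
    show "(\<lambda>n. d + 1 / real (Suc n)) \<longlonglongrightarrow> d" by simp
    show "\<exists>N. \<forall>n\<ge>N. (norm (z - f n))\<^sup>2 \<le> d + 1 / real (Suc n)" using f less_imp_le by blast
  qed
  have "inner v (z - p) = 0" if v: "v \<in> S" for v
  proof (cases "v = 0")
    case False
    \<comment> \<open>This coefficient minimizes the distance from \<open>z - p\<close> to the line
      through \<open>v\<close>.\<close>
    define t where "t = inner v (z - p) / inner v v"
    have vv: "inner v v > 0" using False by simp
    have "p + t *\<^sub>R v \<in> S" using assms(1) pS v by (simp add: subspace_add subspace_scale)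
    from dle[OF this] pd have "(norm (z - p))\<^sup>2 \<le> (norm ((z - p) - t *\<^sub>R v))\<^sup>2"
      unfolding diff_diff_eq by linarith
    also have "\<dots> = (norm (z - p))\<^sup>2 - 2 * t * inner v (z - p) + t * (t * inner v v)"
      unfolding power2_norm_eq_inner by (simp add: inner_diff_left inner_diff_right inner_commute algebra_simps)
    also have "t * inner v v = inner v (z - p)" using vv by (simp add: t_def)
    finally have "t * inner v (z - p) \<le> 0" by simp
    then have "(inner v (z - p))\<^sup>2 / inner v v \<le> 0" by (simp add: t_def power2_eq_square)
    then show ?thesis using vv by (simp add: divide_le_0_iff)
  qed simp
  then show ?thesis using pS by blast
qed

lemma closure_add:
  fixes S :: "'a::real_normed_vector set"
  assumes "\<And>x y. x \<in> S \<Longrightarrow> y \<in> S \<Longrightarrow> x + y \<in> S"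
    and "x \<in> closure S" "y \<in> closure S"
  shows "x + y \<in> closure S"
proof -
  obtain f g where "\<forall>n. f n \<in> S" "f \<longlonglongrightarrow> x" "\<forall>n. g n \<in> S" "g \<longlonglongrightarrow> y"
    using assms(2,3) unfolding closure_sequential by blast
  then show ?thesis
    unfolding closure_sequential using assms(1)
    by (intro exI[of _ "\<lambda>n. f n + g n"]) (auto intro: tendsto_add)
qed

lemma subspace_closure:
  fixes S :: "'a::real_normed_vector set"
  assumes "subspace S"
  shows "subspace (closure S)"
  unfolding subspace_def
proof (intro conjI ballI allI)
  show "0 \<in> closure S" using assms subspace_0 closure_subset by blast
  show "x + y \<in> closure S" if "x \<in> closure S" "y \<in> closure S" for x y
    using closure_add[OF _ that] assms subspace_add by blast
  show "c *\<^sub>R x \<in> closure S" if "x \<in> closure S" for c x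
  proof -
    have "c *\<^sub>R x \<in> (*\<^sub>R) c ` closure S" using that by blast
    also have "\<dots> \<subseteq> closure ((*\<^sub>R) c ` S)"
      by (rule closure_bounded_linear_image_subset[OF bounded_linear_scaleR_right])
    also have "\<dots> \<subseteq> closure S"
      using assms by (intro closure_mono) (auto simp: subspace_scale)
    finally show ?thesis .
  qed
qed

lemma bounded_linear_scaleC: "bounded_linear (\<lambda>x::'a::complex_normed_vector. c *\<^sub>C x)"
  by (rule bounded_linear_intro[of _ "cmod c"])
     (auto simp: scaleC_add_right scaleR_scaleC scaleC_scaleC norm_scaleC mult.commute)

lemma complex_subspace_closure:
  fixes S :: "'a::complex_normed_vector set"
  assumes "complex_vector.subspace S"
  shows "complex_vector.subspace (closure S)"
  unfolding complex_vector.subspace_def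
proof (intro conjI ballI allI)
  show "0 \<in> closure S" using assms complex_vector.subspace_0 closure_subset by blast
  show "x + y \<in> closure S" if "x \<in> closure S" "y \<in> closure S" for x y
    using closure_add[OF _ that] assms complex_vector.subspace_add by blast
  show "c *\<^sub>C x \<in> closure S" if "x \<in> closure S" for c x
  proof -
    have "c *\<^sub>C x \<in> (*\<^sub>C) c ` closure S" using that by blast
    also have "\<dots> \<subseteq> closure ((*\<^sub>C) c ` S)"
      by (rule closure_bounded_linear_image_subset[OF bounded_linear_scaleC])
    also have "\<dots> \<subseteq> closure S"
      using assms by (intro closure_mono) (auto simp: complex_vector.subspace_scale)
    finally show ?thesis .
  qed
qed

lemma complex_subspace_imp_subspace: "complex_vector.subspace V \<Longrightarrow> subspace V"
  unfolding complex_vector.subspace_def subspace_def scaleR_scaleC by blast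

text \<open>On a complex subspace, vanishing of the real part of the inner product suffices, since
  \<open>v\<close> may be replaced by \<open>\<i> v\<close>.\<close>

lemma cinner_orthogonal_iff:
  fixes V :: "'k::complex_hilbert set"
  assumes "complex_vector.subspace V"
  shows "(\<forall>v\<in>V. cinner v z = 0) \<longleftrightarrow> (\<forall>v\<in>V. inner v z = 0)"
proof
  assume L: "\<forall>v\<in>V. inner v z = 0"
  show "\<forall>v\<in>V. cinner v z = 0"
  proof
    fix v assume v: "v \<in> V"
    have "\<i> *\<^sub>C v \<in> V" using assms v by (simp add: complex_vector.subspace_scale)
    then have "Re (cinner (\<i> *\<^sub>C v) z) = 0" using L by (simp add: Re_cinner)
    moreover have "cinner (\<i> *\<^sub>C v) z = cnj (\<i> * cinner z v)"
      using cinner_commute[of "\<i> *\<^sub>C v" z] by (simp add: cinner_scaleC_right)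
    ultimately have "Im (cinner z v) = 0" by simp
    then have "Im (cinner v z) = 0" using cinner_commute[of v z] by simp
    moreover have "Re (cinner v z) = 0" using L v by (simp add: Re_cinner)
    ultimately show "cinner v z = 0" by (simp add: complex_eq_iff)
  qed
qed (simp flip: Re_cinner)

locale closed_complex_subspace =
  fixes V :: "'k::complex_hilbert set"
  assumes csub: "complex_vector.subspace V" and clo: "closed V"
begin

lemma sub: "subspace V" using csub by (rule complex_subspace_imp_subspace)

text \<open>The description behind \<open>orth_proj\<close> uses \<open>cinner\<close>; replacing it
  by \<open>inner\<close> lets the later arguments use real inner products.\<close>

lemma orth_proj_unique:
  assumes "p \<in> V" "\<And>v. v \<in> V \<Longrightarrow> inner v (z - p) = 0"
  shows "orth_proj V z = p"
  unfolding orth_proj_def cinner_orthogonal_iff[OF csub]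
proof (rule the_equality)
  fix q assume q: "q \<in> V \<and> (\<forall>v\<in>V. inner v (z - q) = 0)"
  have "q - p \<in> V" using q assms(1) sub subspace_diff by blast
  then have "inner (q - p) (z - p) = 0" "inner (q - p) (z - q) = 0" using q assms(2) by auto
  then have "inner (q - p) (q - p) = 0" by (simp add: inner_diff_right)
  then show "q = p" by simp
qed (use assms in auto)

lemma orth_proj_ex: "orth_proj V z \<in> V \<and> (\<forall>v\<in>V. inner v (z - orth_proj V z) = 0)"
  using complete_subspace_projection[OF sub clo, of z] orth_proj_unique[of _ z] by auto

lemma orth_proj_in: "orth_proj V z \<in> V" using orth_proj_ex by blast

lemma inner_orth_proj: "v \<in> V \<Longrightarrow> inner v (orth_proj V z) = inner v z"
  using orth_proj_ex[of z] by (simp add: inner_diff_right)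

lemma orth_proj_id: "v \<in> V \<Longrightarrow> orth_proj V v = v"
  by (rule orth_proj_unique) auto

lemma orth_proj_eq_0: "(\<And>v. v \<in> V \<Longrightarrow> inner v z = 0) \<Longrightarrow> orth_proj V z = 0"
  by (rule orth_proj_unique) (auto simp: subspace_0 sub)

lemma orth_proj_selfadj: "inner (orth_proj V x) y = inner x (orth_proj V y)"
  using inner_orth_proj[OF orth_proj_in[of x], of y] inner_orth_proj[OF orth_proj_in[of y], of x]
  by (simp add: inner_commute)

lemma inner_orth_proj_self: "inner x (orth_proj V x) = (norm (orth_proj V x))\<^sup>2"
  by (metis orth_proj_id orth_proj_in orth_proj_selfadj power2_norm_eq_inner)

lemma norm_orth_proj_le: "norm (orth_proj V x) \<le> norm x"
proof -
  have "(norm (orth_proj V x))\<^sup>2 \<le> norm x * norm (orth_proj V x)"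
    using norm_cauchy_schwarz[of x "orth_proj V x"] by (simp add: inner_orth_proj_self)
  then show ?thesis
    by (cases "norm (orth_proj V x) = 0") (auto simp: power2_eq_square)
qed

lemma pythagoras: "(norm x)\<^sup>2 = (norm (orth_proj V x))\<^sup>2 + (norm (x - orth_proj V x))\<^sup>2"
  using inner_orth_proj_self[of x]
  by (simp add: power2_norm_eq_inner inner_diff_left inner_diff_right inner_commute)

lemma linear_orth_proj: "linear (orth_proj V)"
proof (rule linearI)
  show "orth_proj V (x + y) = orth_proj V x + orth_proj V y" for x y
    by (rule orth_proj_unique)
       (auto simp: subspace_add sub orth_proj_in inner_diff_right inner_add_right inner_orth_proj)
  show "orth_proj V (r *\<^sub>R x) = r *\<^sub>R orth_proj V x" for r x
    by (rule orth_proj_unique)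
       (auto simp: subspace_scale sub orth_proj_in inner_diff_right inner_orth_proj)
qed

lemma bounded_linear_orth_proj: "bounded_linear (orth_proj V)"
  using linear_orth_proj norm_orth_proj_le
  by (auto intro!: bounded_linear.intro bounded_linear_axioms.intro exI[of _ 1])

end

text \<open>The complement is taken for the real inner product; on a complex subspace it agrees with
  the one for \<open>cinner\<close>, by \<open>cinner_orthogonal_iff\<close>.\<close>

definition orth_comp :: "'a::real_inner set \<Rightarrow> 'a set" where
  "orth_comp V = {x. \<forall>v\<in>V. inner v x = 0}"

lemma (in closed_complex_subspace) orth_comp_orth_comp: "orth_comp (orth_comp V) = V"
proof
  show "V \<subseteq> orth_comp (orth_comp V)" by (auto simp: orth_comp_def inner_commute)
  show "orth_comp (orth_comp V) \<subseteq> V"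
  proof
    fix v assume v: "v \<in> orth_comp (orth_comp V)"
    have p: "inner u (v - orth_proj V v) = 0" if "u \<in> V" for u
      using that by (simp add: inner_diff_right inner_orth_proj)
    then have "inner (v - orth_proj V v) v = 0" using v by (simp add: orth_comp_def)
    moreover have "inner (v - orth_proj V v) (orth_proj V v) = 0"
      using p[OF orth_proj_in] by (simp add: inner_commute)
    ultimately have "inner (v - orth_proj V v) (v - orth_proj V v) = 0" by (simp add: inner_diff_right)
    then show "v \<in> V" using orth_proj_in[of v] by simp
  qed
qed

lemma closed_orth_comp: "closed (orth_comp V)"
proof -
  have "orth_comp V = (\<Inter>v\<in>V. {x. inner v x = 0})" by (auto simp: orth_comp_def)
  moreover have "closed {x. inner v x = 0}" for v :: 'a
    by (intro closed_Collect_eq continuous_intros)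
  ultimately show ?thesis by auto
qed

section \<open>The Friedrichs angle of two closed subspaces\<close>

text \<open>The cosine enters the argument only through its nonnegative upper bounds
  \<open>s\<close>, which this relation expresses without an operator norm.\<close>

definition friedrichs_le :: "'k::complex_hilbert set \<Rightarrow> 'k set \<Rightarrow> real \<Rightarrow> bool" where
  "friedrichs_le V W s \<longleftrightarrow> (\<forall>w \<in> W \<inter> orth_comp (V \<inter> W). norm (orth_proj V w) \<le> s * norm w)"

text \<open>With \<open>A = q p q\<close> this is \<open>(1 - A)(s\<^sup>2 - A)(1 - A)\<close>; it is used both for projections of the
  module and for projections of a Hilbert space. On the spectrum of \<open>A\<close>, the factor \<open>(1 - A)\<^sup>2\<close> only
  disregards the eigenvalue 1, which belongs to the intersection.\<close>

definition friedrichs_op :: "real \<Rightarrow> ('a \<Rightarrow> 'a) \<Rightarrow> ('a \<Rightarrow> 'a) \<Rightarrow> 'a::real_vector \<Rightarrow> 'a" where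
  "friedrichs_op s p q z =
     (let a = (\<lambda>x. q (p (q x))); b = (\<lambda>x. x - a x) in b (s\<^sup>2 *\<^sub>R b z - a (b z)))"

locale subspace_pair = V: closed_complex_subspace V + W: closed_complex_subspace W
  for V W :: "'k::complex_hilbert set"
begin

sublocale VW: closed_complex_subspace "V \<inter> W"
  by unfold_locales
     (auto intro!: closed_Int V.clo W.clo complex_vector.subspace_inter V.csub W.csub)

abbreviation "P \<equiv> orth_proj V"
abbreviation "Q \<equiv> orth_proj W"
abbreviation "R \<equiv> orth_proj (V \<inter> W)"

lemma bounded_linear_friedrichs: "bounded_linear (\<lambda>z. P (Q z) - R z)"
  by (intro bounded_linear_sub bounded_linear_compose[OF V.bounded_linear_orth_proj]
      W.bounded_linear_orth_proj VW.bounded_linear_orth_proj)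

text \<open>The operator sends \<open>z\<close> to \<open>P w\<close> with
  \<open>w = Q (z - R z)\<close>, a vector of \<open>W\<close> orthogonal to
  \<open>V \<inter> W\<close> and no longer than \<open>z\<close>. Conversely, on such
  \<open>w\<close> the operator acts as \<open>P\<close>.\<close>

lemma onorm_friedrichs_iff:
  assumes "0 \<le> s"
  shows "onorm (\<lambda>z. P (Q z) - R z) \<le> s \<longleftrightarrow> friedrichs_le V W s"
proof
  assume le: "onorm (\<lambda>z. P (Q z) - R z) \<le> s"
  show "friedrichs_le V W s"
    unfolding friedrichs_le_def
  proof
    fix w assume w: "w \<in> W \<inter> orth_comp (V \<inter> W)"
    have "R w = 0" by (rule VW.orth_proj_eq_0) (use w in \<open>auto simp: orth_comp_def\<close>)
    then have "norm (P w) = norm (P (Q w) - R w)" using w by (simp add: W.orth_proj_id)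
    also have "\<dots> \<le> onorm (\<lambda>z. P (Q z) - R z) * norm w" by (rule onorm[OF bounded_linear_friedrichs])
    also have "\<dots> \<le> s * norm w" using le by (intro mult_right_mono) auto
    finally show "norm (P w) \<le> s * norm w" .
  qed
next
  assume fr: "friedrichs_le V W s"
  show "onorm (\<lambda>z. P (Q z) - R z) \<le> s"
  proof (rule onorm_bound)
    fix z
    have RW: "R z \<in> W" "R z \<in> V" using VW.orth_proj_in by auto
    define w where "w = Q z - R z"
    have wW: "w \<in> W" unfolding w_def using RW W.orth_proj_in W.sub subspace_diff by blast
    have "w \<in> orth_comp (V \<inter> W)"
      by (auto simp: w_def orth_comp_def inner_diff_right W.inner_orth_proj VW.inner_orth_proj)
    then have *: "norm (P w) \<le> s * norm w" using fr wW by (auto simp: friedrichs_le_def)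
    have "w = Q (z - R z)"
      using RW by (simp add: w_def linear_diff[OF W.linear_orth_proj] W.orth_proj_id)
    then have "norm w \<le> norm (z - R z)" using W.norm_orth_proj_le by metis
    also have "\<dots> \<le> norm z"
      using VW.pythagoras[of z] by (simp add: power2_le_imp_le)
    finally have "norm w \<le> norm z" .
    have "P (Q z) - R z = P w"
      using RW by (simp add: w_def linear_diff[OF V.linear_orth_proj] V.orth_proj_id)
    then show "norm (P (Q z) - R z) \<le> s * norm z"
      using * \<open>norm w \<le> norm z\<close> assms by (metis mult_left_mono order_trans)
  qed (rule assms)
qed

text \<open>\<open>P\<close> on the reduced part of \<open>W\<close> and \<open>Q\<close> on the
  reduced part of \<open>V\<close> are adjoint to each other, so they obey the same norm
  bound.\<close>

lemma friedrichs_le_commute: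
  assumes "friedrichs_le V W s" "0 \<le> s"
  shows "friedrichs_le W V s"
  unfolding friedrichs_le_def
proof
  fix v assume v: "v \<in> V \<inter> orth_comp (W \<inter> V)"
  then have "Q v \<in> W \<inter> orth_comp (V \<inter> W)"
    by (auto simp: orth_comp_def W.inner_orth_proj W.orth_proj_in)
  then have "norm (P (Q v)) \<le> s * norm (Q v)" using assms by (simp add: friedrichs_le_def)
  have "(norm (Q v))\<^sup>2 = inner v (P (Q v))"
    using v by (simp add: W.inner_orth_proj_self V.inner_orth_proj)
  also have "\<dots> \<le> norm v * norm (P (Q v))" by (rule norm_cauchy_schwarz)
  also have "\<dots> \<le> norm v * (s * norm (Q v))"
    using \<open>norm (P (Q v)) \<le> _\<close> by (intro mult_left_mono) auto
  finally have "norm (Q v) * norm (Q v) \<le> (s * norm v) * norm (Q v)"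
    by (simp add: power2_eq_square mult_ac)
  then show "norm (Q v) \<le> s * norm v"
    using assms(2) by (cases "norm (Q v) = 0") auto
qed

lemma orth_comp_proj:
  assumes "closed_complex_subspace (orth_comp V)"
  shows "orth_proj (orth_comp V) z = z - P z"
proof (rule closed_complex_subspace.orth_proj_unique[OF assms])
  show "z - P z \<in> orth_comp V" by (simp add: orth_comp_def inner_diff_right V.inner_orth_proj)
  show "inner v (z - (z - P z)) = 0" if "v \<in> orth_comp V" for v
    using that V.orth_proj_in[of z] by (auto simp: orth_comp_def inner_commute)
qed

text \<open>For \<open>v \<in> V\<close> orthogonal to \<open>V \<inter> W\<close>, the vector \<open>y = v - Q v\<close> satisfies
  \<open>\<parallel>y\<parallel>\<^sup>2 = \<langle>P y, v\<rangle>\<close> and \<open>(1 - s\<^sup>2) \<parallel>v\<parallel>\<^sup>2 \<le> \<parallel>y\<parallel>\<^sup>2\<close>; such \<open>y\<close> are dense in the part of the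
  complement of \<open>W\<close> that is orthogonal to the complement of \<open>V\<close>.\<close>

lemma friedrichs_le_orth_comp:
  assumes fr: "friedrichs_le V W s" and s: "0 \<le> s"
    and V': "closed_complex_subspace (orth_comp V)"
  shows "friedrichs_le (orth_comp V) (orth_comp W) s"
proof (cases "s < 1")
  \<comment> \<open>For \<open>s \<ge> 1\<close> the bound is the contractivity of projections;
    below 1 the factor \<open>1 - s\<^sup>2\<close> is positive and can be multiplied
    through.\<close>
  case False
  have "norm (orth_proj (orth_comp V) w) \<le> s * norm w" for w
    using closed_complex_subspace.norm_orth_proj_le[OF V', of w] False
      mult_right_mono[of 1 s "norm w"] by simp
  then show ?thesis by (simp add: friedrichs_le_def)
next
  case True
  then have s2: "1 - s\<^sup>2 > 0" using s by (simp add: abs_square_less_1)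
  \<comment> \<open>By Pythagoras, membership of \<open>w\<close> in this closed set is the required
    bound on \<open>w - P w\<close>.\<close>
  let ?C = "{y. (1 - s\<^sup>2) * (norm y)\<^sup>2 \<le> (norm (P y))\<^sup>2}"
  note [continuous_intros] = bounded_linear.continuous_on[OF V.bounded_linear_orth_proj]
    bounded_linear.continuous_on[OF W.bounded_linear_orth_proj]
  have closedC: "closed ?C" by (intro closed_Collect_le continuous_intros)
  have rangeC: "v - Q v \<in> ?C" if v: "v \<in> V" for v
  proof -
    \<comment> \<open>Subtracting \<open>R v\<close>, which lies in \<open>W\<close>, leaves
      \<open>v - Q v\<close> unchanged and makes the symmetric bound applicable.\<close>
    define v1 where "v1 = v - R v"
    have RV: "R v \<in> V" "R v \<in> W" using VW.orth_proj_in by auto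
    have y: "v - Q v = v1 - Q v1"
      using RV by (simp add: v1_def linear_diff[OF W.linear_orth_proj] W.orth_proj_id)
    have v1V: "v1 \<in> V" using v RV V.sub subspace_diff unfolding v1_def by blast
    have "v1 \<in> orth_comp (W \<inter> V)"
      by (auto simp: v1_def orth_comp_def inner_diff_right VW.inner_orth_proj)
    then have Q1: "norm (Q v1) \<le> s * norm v1"
      using friedrichs_le_commute[OF fr s] v1V by (simp add: friedrichs_le_def)
    define y where "y = v1 - Q v1"
    have "(norm (Q v1))\<^sup>2 \<le> s\<^sup>2 * (norm v1)\<^sup>2"
      using power_mono[OF Q1, of 2] by (simp add: power_mult_distrib)
    then have yv: "(1 - s\<^sup>2) * (norm v1)\<^sup>2 \<le> (norm y)\<^sup>2"
      using W.pythagoras[of v1] by (simp add: y_def algebra_simps)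
    have "inner (Q v1) y = 0"
      by (simp add: y_def inner_diff_right W.inner_orth_proj W.orth_proj_in)
    then have "(norm y)\<^sup>2 = inner v1 y"
      by (simp add: power2_norm_eq_inner y_def inner_diff_left)
    also have "\<dots> = inner v1 (P y)" using v1V by (simp add: V.inner_orth_proj)
    also have "\<dots> \<le> norm v1 * norm (P y)" by (rule norm_cauchy_schwarz)
    finally have "((norm y)\<^sup>2)\<^sup>2 \<le> (norm v1)\<^sup>2 * (norm (P y))\<^sup>2"
      using power_mono[of "(norm y)\<^sup>2" _ 2] by (fastforce simp: power_mult_distrib)
    then have "(1 - s\<^sup>2) * ((norm y)\<^sup>2)\<^sup>2 \<le> ((1 - s\<^sup>2) * (norm v1)\<^sup>2) * (norm (P y))\<^sup>2"
      using s2 by simp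
    also have "\<dots> \<le> (norm y)\<^sup>2 * (norm (P y))\<^sup>2" using yv by (intro mult_right_mono) auto
    finally have "(norm y)\<^sup>2 * ((1 - s\<^sup>2) * (norm y)\<^sup>2) \<le> (norm y)\<^sup>2 * (norm (P y))\<^sup>2"
      by (simp add: power2_eq_square mult_ac)
    then have "y \<in> ?C" by (cases "norm y = 0") auto
    then show ?thesis using y y_def by simp
  qed
  let ?S = "closure ((\<lambda>v. v - Q v) ` V)"
  have lin: "linear (\<lambda>v. v - Q v)" by (intro linear_compose_sub W.linear_orth_proj linear_id[unfolded id_def])
  have subS: "subspace ?S"
    by (intro subspace_closure linear_subspace_image lin V.sub)
  have "?S \<subseteq> ?C" using rangeC closedC by (intro closure_minimal) auto
  show ?thesis
    unfolding friedrichs_le_def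
  proof
    fix w assume w: "w \<in> orth_comp W \<inter> orth_comp (orth_comp V \<inter> orth_comp W)"
    \<comment> \<open>The remainder \<open>w - e\<close> turns out to lie in both complements, while
      \<open>w\<close> is orthogonal to their intersection; so it vanishes and \<open>w\<close> lies
      in \<open>?S\<close>.\<close>
    obtain e where e: "e \<in> ?S" "\<And>v. v \<in> ?S \<Longrightarrow> inner v (w - e) = 0"
      using complete_subspace_projection[OF subS closed_closure] by metis
    have "?S \<subseteq> orth_comp W"
      by (intro closure_minimal closed_orth_comp)
         (auto simp: orth_comp_def inner_diff_right W.inner_orth_proj)
    then have f: "w - e \<in> orth_comp W"
      using w e(1) by (auto simp: orth_comp_def inner_diff_right)
    then have "inner (v - Q v) (w - e) = 0 \<and> inner (Q v) (w - e) = 0" if "v \<in> V" for v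
      using e(2)[of "v - Q v"] that W.orth_proj_in[of v]
        subsetD[OF closure_subset, of "v - Q v" "(\<lambda>v. v - Q v) ` V"] by (auto simp: orth_comp_def)
    then have "w - e \<in> orth_comp V" by (auto simp: orth_comp_def inner_diff_left)
    then have "inner (w - e) w = 0" using w f by (auto simp: orth_comp_def)
    moreover have "inner (w - e) e = 0" using e by (simp add: inner_commute)
    ultimately have "inner (w - e) (w - e) = 0" by (simp add: inner_diff_right)
    then have "w \<in> ?C" using e(1) \<open>?S \<subseteq> ?C\<close> by auto
    then have "(norm (w - P w))\<^sup>2 \<le> (s * norm w)\<^sup>2"
      using V.pythagoras[of w] by (simp add: power_mult_distrib algebra_simps)
    then show "norm (orth_proj (orth_comp V) w) \<le> s * norm w"
      unfolding orth_comp_proj[OF V'] by (rule power2_le_imp_le) (simp add: s)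
  qed
qed

text \<open>With \<open>B = 1 - A\<close> the quadratic form is \<open>s\<^sup>2 * (norm (B
  z))\<^sup>2 - (norm (P (Q (B z))))\<^sup>2\<close>. The range of \<open>B\<close> is orthogonal to
  \<open>V \<inter> W\<close>, which gives one direction. For the other, the kernel of the
  self-adjoint \<open>B\<close> lies in \<open>V \<inter> W\<close>, so the closure of its range
  contains every \<open>w\<close> to be tested.\<close>

lemma friedrichs_le_iff_op_nonneg:
  assumes s: "0 \<le> s"
  shows "friedrichs_le V W s \<longleftrightarrow> (\<forall>z. 0 \<le> inner z (friedrichs_op s P Q z))"
proof -
  define A where "A z = Q (P (Q z))" for z
  define B where "B z = z - A z" for z
  have linA: "linear A" unfolding A_def
    using linear_compose[OF linear_compose[OF W.linear_orth_proj V.linear_orth_proj] W.linear_orth_proj]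
    by (simp add: o_def)
  have linB: "linear B" unfolding B_def
    by (intro linear_compose_sub linA linear_id[unfolded id_def])
  have adjA: "inner (A x) y = inner x (A y)" for x y
    by (simp add: A_def W.orth_proj_selfadj V.orth_proj_selfadj)
  have adjB: "inner (B x) y = inner x (B y)" for x y
    by (simp add: B_def inner_diff_left inner_diff_right adjA)
  have AP: "inner x (A x) = (norm (P (Q x)))\<^sup>2" for x
    by (simp add: A_def flip: W.orth_proj_selfadj V.inner_orth_proj_self)
  have form: "inner z (friedrichs_op s P Q z) = s\<^sup>2 * (norm (B z))\<^sup>2 - (norm (P (Q (B z))))\<^sup>2" for z
  proof -
    have "friedrichs_op s P Q z = B (s\<^sup>2 *\<^sub>R B z - A (B z))"
      by (simp add: friedrichs_op_def B_def A_def Let_def)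
    then show ?thesis by (simp add: inner_diff_right AP power2_norm_eq_inner flip: adjB)
  qed
  have RA: "inner u (B z) = 0" if "u \<in> V \<inter> W" for u z
    using that by (simp add: B_def A_def inner_diff_right W.inner_orth_proj V.inner_orth_proj)
  show ?thesis
    unfolding form
  proof (intro iffI allI)
    fix z assume fr: "friedrichs_le V W s"
    have "Q (B z) \<in> W \<inter> orth_comp (V \<inter> W)"
      using RA by (auto simp: orth_comp_def W.inner_orth_proj W.orth_proj_in)
    then have "norm (P (Q (B z))) \<le> s * norm (Q (B z))" using fr by (simp add: friedrichs_le_def)
    also have "\<dots> \<le> s * norm (B z)" using s W.norm_orth_proj_le by (intro mult_left_mono)
    finally show "0 \<le> s\<^sup>2 * (norm (B z))\<^sup>2 - (norm (P (Q (B z))))\<^sup>2"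
      using power_mono[of "norm (P (Q (B z)))" _ 2] by (fastforce simp: power_mult_distrib)
  next
    assume pos: "\<forall>z. 0 \<le> s\<^sup>2 * (norm (B z))\<^sup>2 - (norm (P (Q (B z))))\<^sup>2"
    let ?C = "{y. (norm (P (Q y)))\<^sup>2 \<le> s\<^sup>2 * (norm y)\<^sup>2}"
    let ?S = "closure (range B)"
    note [continuous_intros] = bounded_linear.continuous_on[OF V.bounded_linear_orth_proj]
      bounded_linear.continuous_on[OF W.bounded_linear_orth_proj]
    have "closed ?C" by (intro closed_Collect_le continuous_intros)
    then have SC: "?S \<subseteq> ?C" using pos by (intro closure_minimal) auto
    have subS: "subspace ?S" by (intro subspace_closure linear_subspace_image linB subspace_UNIV)
    show "friedrichs_le V W s"
      unfolding friedrichs_le_def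
    proof
      fix w assume w: "w \<in> W \<inter> orth_comp (V \<inter> W)"
      obtain e where e: "e \<in> ?S" "\<And>v. v \<in> ?S \<Longrightarrow> inner v (w - e) = 0"
        using complete_subspace_projection[OF subS closed_closure] by metis
      define f where "f = w - e"
      have "inner z (B f) = 0" for z
        using e(2)[of "B z"] closure_subset[of "range B"] by (auto simp: f_def adjB)
      from this[of "B f"] have Af: "f = Q (P (Q f))" by (simp add: B_def A_def)
      then have fW: "f \<in> W" by (metis W.orth_proj_in)
      \<comment> \<open>Equality in the contraction estimate for \<open>P\<close> forces
        \<open>f\<close> into \<open>V\<close>.\<close>
      then have "norm f \<le> norm (P f)" using Af W.orth_proj_id W.norm_orth_proj_le by metis
      then have "norm (f - P f) = 0" using V.pythagoras[of f] power_mono[of "norm f" "norm (P f)" 2]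
        by (simp add: order_antisym)
      then have "f \<in> V" using V.orth_proj_in[of f] by simp
      then have "inner f w = 0" using w fW by (auto simp: orth_comp_def)
      moreover have "inner f e = 0" using e by (simp add: f_def inner_commute)
      ultimately have "inner f f = 0" by (simp add: f_def inner_diff_right)
      then have "w \<in> ?C" using e(1) SC by (auto simp: f_def)
      then have "(norm (P w))\<^sup>2 \<le> (s * norm w)\<^sup>2"
        using w by (simp add: power_mult_distrib W.orth_proj_id)
      then show "norm (P w) \<le> s * norm w" by (rule power2_le_imp_le) (simp add: s)
    qed
  qed
qed

lemma continuous_friedrichs_op: "continuous_on UNIV (friedrichs_op s P Q)"
proof -
  note [continuous_intros] = bounded_linear.continuous_on[OF V.bounded_linear_orth_proj]
    bounded_linear.continuous_on[OF W.bounded_linear_orth_proj]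
  show ?thesis unfolding friedrichs_op_def Let_def by (intro continuous_intros)
qed

end

section \<open>A square root by power series iteration\<close>

text \<open>The operator \<open>1 - Y\<close> is the square root of \<open>1 - U\<close>. The iteration \<open>Y \<mapsto> (U + Y\<^sup>2) / 2\<close> has
  nonnegative coefficients, so its increments are dominated by those of the scalar iteration
  at \<open>U = 1\<close>. The last clause transfers to \<open>Y\<close> every closed property inherited along the iteration.\<close>

lemma blinfun_sqrt:
  fixes U :: "'a::banach \<Rightarrow>\<^sub>L 'a"
  assumes U: "norm U \<le> 1"
  obtains Y where "norm Y \<le> 1" "2 *\<^sub>R Y = U + (Y o\<^sub>L Y)"
    "\<forall>C. closed C \<longrightarrow> 0 \<in> C \<longrightarrow> (\<forall>Y\<in>C. (1/2) *\<^sub>R (U + (Y o\<^sub>L Y)) \<in> C) \<longrightarrow> Y \<in> C"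
proof -
  note cmp = bounded_bilinear_blinfun_compose
  define F where "F Y = (1/2) *\<^sub>R (U + (Y o\<^sub>L Y))" for Y
  define y where "y n = (F ^^ n) 0" for n
  define e where "e n = ((\<lambda>t::real. (1 + t\<^sup>2) / 2) ^^ n) 0" for n
  have y0: "y 0 = 0" and yS: "y (Suc n) = F (y n)" for n by (simp_all add: y_def)
  have e0: "e 0 = 0" and eS: "e (Suc n) = (1 + (e n)\<^sup>2) / 2" for n by (simp_all add: e_def)
  have e01: "0 \<le> e n \<and> e n \<le> 1" for n
    by (induction n) (auto simp: e0 eS power_le_one)
  have ye: "norm (y n) \<le> e n" for n
  proof (induction n)
    case (Suc n)
    have "norm (y n o\<^sub>L y n) \<le> norm (y n) * norm (y n)" by (rule norm_blinfun_compose)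
    also have "\<dots> \<le> e n * e n" using Suc e01 by (intro mult_mono) auto
    finally have "norm (U + (y n o\<^sub>L y n)) \<le> 1 + e n * e n"
      using U norm_triangle_ineq[of U "y n o\<^sub>L y n"] by linarith
    then show ?case by (simp add: yS eS F_def power2_eq_square)
  qed (simp add: y0 e0)
  have dye: "norm (y (Suc n) - y n) \<le> e (Suc n) - e n" for n
  proof (induction n)
    case 0 then show ?case using U by (simp add: yS y0 e0 eS F_def bounded_bilinear.zero_left[OF cmp])
  next
    case (Suc n)
    define a b where "a = y (Suc n)" and "b = y n"
    \<comment> \<open>The difference of squares is split as \<open>a (a - b) + (a - b) b\<close>,
      which is valid without commutation.\<close>
    have "y (Suc (Suc n)) - y (Suc n) = (1/2) *\<^sub>R ((a o\<^sub>L (a - b)) + ((a - b) o\<^sub>L b))"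
      unfolding yS[of "Suc n"] unfolding yS[of n] a_def[symmetric] b_def[symmetric]
      by (simp add: F_def b_def yS a_def bounded_bilinear.diff_left[OF cmp] bounded_bilinear.diff_right[OF cmp]
          scaleR_right_diff_distrib scaleR_add_right)
    then have "2 * norm (y (Suc (Suc n)) - y (Suc n)) = norm ((a o\<^sub>L (a - b)) + ((a - b) o\<^sub>L b))"
      by simp
    also have "\<dots> \<le> norm a * norm (a - b) + norm (a - b) * norm b"
      by (intro norm_triangle_mono norm_blinfun_compose)
    also have "\<dots> \<le> e (Suc n) * (e (Suc n) - e n) + (e (Suc n) - e n) * e n"
      using ye[of n] ye[of "Suc n"] Suc e01[of n] e01[of "Suc n"] order_trans[OF norm_ge_zero Suc]
      by (intro add_mono mult_mono) (auto simp: a_def b_def)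
    also have "\<dots> = 2 * (e (Suc (Suc n)) - e (Suc n))"
      unfolding eS[of "Suc n"] by (subst (3) eS) (simp add: power2_eq_square algebra_simps)
    finally show ?case by simp
  qed
  \<comment> \<open>The scalar sequence is increasing and bounded, so its increments are summable,
    and hence so are those of \<open>y\<close>.\<close>
  have "e n \<le> e (Suc n)" for n using order_trans[OF norm_ge_zero dye[of n]] by simp
  then have "monoseq e" by (intro incseq_imp_monoseq incseq_SucI)
  moreover have "Bseq e" using e01 by (intro BseqI'[of _ 1]) simp
  ultimately obtain l where "e \<longlonglongrightarrow> l"
    using Bseq_monoseq_convergent unfolding convergent_def by blast
  then have "summable (\<lambda>n. e (Suc n) - e n)" by (rule telescope_summable)
  then have "summable (\<lambda>n. y (Suc n) - y n)"
    by (rule summable_comparison_test[rotated]) (use dye in simp)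
  then have "convergent (\<lambda>n. \<Sum>i<n. y (Suc i) - y i)" by (simp add: summable_iff_convergent)
  then obtain Y where Y: "y \<longlonglongrightarrow> Y"
    by (auto simp: convergent_def sum_lessThan_telescope y0)
  show ?thesis
  proof
    show "norm Y \<le> 1"
      using ye e01 by (intro LIMSEQ_le_const2[OF tendsto_norm[OF Y]]) (meson order_trans)
    have "(\<lambda>n. 2 *\<^sub>R y (Suc n)) \<longlonglongrightarrow> U + (Y o\<^sub>L Y)"
      unfolding yS F_def by (auto intro!: tendsto_add bounded_bilinear.tendsto[OF cmp] Y)
    moreover have "(\<lambda>n. 2 *\<^sub>R y (Suc n)) \<longlonglongrightarrow> 2 *\<^sub>R Y" by (intro tendsto_intros LIMSEQ_Suc Y)
    ultimately show "2 *\<^sub>R Y = U + (Y o\<^sub>L Y)" using LIMSEQ_unique by blast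
    show "\<forall>C. closed C \<longrightarrow> 0 \<in> C \<longrightarrow> (\<forall>Y\<in>C. (1/2) *\<^sub>R (U + (Y o\<^sub>L Y)) \<in> C) \<longrightarrow> Y \<in> C"
    proof (intro allI impI)
      fix C assume C: "closed C" "0 \<in> C" "\<forall>Y\<in>C. (1/2) *\<^sub>R (U + (Y o\<^sub>L Y)) \<in> C"
      have "y n \<in> C" for n by (induction n) (auto simp: y0 yS F_def C)
      then show "Y \<in> C" using closed_sequentially[OF C(1) _ Y] by blast
    qed
  qed
qed

section \<open>Continuity of the algebra-valued inner product\<close>

lemma norm_adj: "norm (adj a) = norm (a::'b::cstar_algebra)"
proof -
  have le: "norm a \<le> norm (adj a)" for a :: 'b
  proof -
    have "norm a * norm a \<le> norm (adj a) * norm a"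
      using norm_mult_ineq[of "adj a" a] by (simp add: cstar_identity power2_eq_square)
    then show ?thesis by (cases "a = 0") auto
  qed
  show ?thesis using le[of a] le[of "adj a"] by (simp add: adj_adj)
qed

context hilbert_module
begin

lemma ip_add_left: "ip (x + y) z = ip x z + ip y z"
  by (metis adj_add ip_add_right ip_adj)

lemma ip_scaleC_left: "ip (c *\<^sub>C x) y = cnj c *\<^sub>C ip x y"
  by (metis adj_scaleC ip_scaleC_right ip_adj)

lemma ip_scaleR_right: "ip x (r *\<^sub>R y) = r *\<^sub>R ip x y"
  by (simp add: scaleR_scaleC ip_scaleC_right)

lemma ip_scaleR_left: "ip (r *\<^sub>R x) y = r *\<^sub>R ip x y"
  by (simp add: scaleR_scaleC ip_scaleC_left)

lemma ip_diff_right: "ip x (y - z) = ip x y - ip x z"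
  using ip_add_right[of x y "- z"] ip_scaleR_right[of x "-1" z] by simp

lemma ip_diff_left: "ip (x - y) z = ip x z - ip y z"
  using ip_add_left[of x "- y" z] ip_scaleR_left[of "-1" y z] by simp

lemma norm_ip_self: "norm (ip x x) = (norm x)\<^sup>2"
  by (simp add: norm_ip[of x])

lemma ip_eq_0D: "ip x x = 0 \<Longrightarrow> x = 0"
  using norm_ip_self[of x] by simp

text \<open>Polarization gives only this weak form of the Cauchy-Schwarz inequality, but it is enough
  for continuity of \<open>ip\<close> and needs no order on the algebra.\<close>

lemma norm_ip_le: "norm (ip x y) \<le> (norm x + norm y)\<^sup>2"
proof -
  have n: "norm (ip (x + c *\<^sub>C y) (x + c *\<^sub>C y)) \<le> (norm x + norm y)\<^sup>2" if "cmod c = 1" for c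
    unfolding norm_ip_self
    using norm_triangle_ineq[of x "c *\<^sub>C y"] that by (intro power_mono) (auto simp: norm_scaleC)
  \<comment> \<open>The fourth roots of unity and their squares both sum to zero, so summing
    \<open>a c\<close> over these roots leaves four copies of \<open>ip x y\<close>.\<close>
  define a where "a c = c *\<^sub>C ip (x + cnj c *\<^sub>C y) (x + cnj c *\<^sub>C y)" for c
  have na: "norm (a c) \<le> (norm x + norm y)\<^sup>2" if "cmod c = 1" for c
    using n[of "cnj c"] that by (simp add: a_def norm_scaleC)
  have "a c = c *\<^sub>C ip x x + ip x y + (c * c) *\<^sub>C ip y x + c *\<^sub>C ip y y" if "cmod c = 1" for c
  proof -
    have "c * cnj c = 1" using that by (simp add: complex_norm_square[symmetric])
    then show ?thesis
      by (simp add: a_def ip_add_left ip_add_right ip_scaleC_left ip_scaleC_right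
          scaleC_add_right scaleC_scaleC scaleC_one mult.assoc mult.commute[of "cnj c"])
  qed
  note ac = this
  have m1: "(-1) *\<^sub>C z = - z" for z :: 'b using scaleR_scaleC[of "-1" z] by simp
  have mi: "(-\<i>) *\<^sub>C z = - (\<i> *\<^sub>C z)" for z :: 'b
    using scaleC_scaleC[of "-1" "\<i>" z] by (simp add: m1)
  have "4 *\<^sub>R ip x y = a 1 + a (-1) + a \<i> + a (-\<i>)"
    unfolding ac[of 1, simplified] ac[of "-1", simplified] ac[of "\<i>", simplified] ac[of "-\<i>", simplified]
    using scaleR_add_left[of 2 2 "ip x y"] by (simp add: m1 mi scaleC_one scaleR_2)
  then have "4 * norm (ip x y) = norm (a 1 + a (-1) + a \<i> + a (-\<i>))"
    by (metis norm_scaleR abs_numeral)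
  also have "\<dots> \<le> norm (a 1) + norm (a (-1)) + norm (a \<i>) + norm (a (-\<i>))"
    by (intro norm_triangle_mono order_refl)
  also have "\<dots> \<le> 4 * (norm x + norm y)\<^sup>2"
    using na[of 1] na[of "-1"] na[of "\<i>"] na[of "-\<i>"] by simp
  finally show ?thesis by simp
qed

text \<open>Rescaling \<open>y\<close> to norm one turns the quadratic estimate into one that is
  linear in \<open>y\<close>.\<close>

lemma norm_ip_le_mult: "norm (ip x y) \<le> norm y * (norm x + 1)\<^sup>2"
proof (cases "y = 0")
  case False
  have "norm (ip x ((1 / norm y) *\<^sub>R y)) \<le> (norm x + 1)\<^sup>2"
    using norm_ip_le[of x "(1 / norm y) *\<^sub>R y"] False by simp
  then show ?thesis using False by (simp add: ip_scaleR_right field_simps)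
qed (use ip_scaleR_right[of x 0 0] in simp)

lemma bounded_linear_ip_right: "bounded_linear (ip x)"
  by (rule bounded_linear_intro[OF _ _ norm_ip_le_mult]) (simp_all add: ip_add_right ip_scaleR_right)

lemma bounded_linear_ip_left: "bounded_linear (\<lambda>x. ip x y)"
proof (rule bounded_linear_intro)
  show "norm (ip x y) \<le> norm x * (norm y + 1)\<^sup>2" for x
    using norm_ip_le_mult[of y x] norm_adj[of "ip x y"] by (simp add: ip_adj)
qed (simp_all add: ip_add_left ip_scaleR_left)

section \<open>Square roots and absolute values of self-adjoint operators on the module\<close>

definition selfadjoint :: "('x \<Rightarrow> 'x) \<Rightarrow> bool" where
  "selfadjoint T \<longleftrightarrow> (\<forall>x y. ip (T x) y = ip x (T y))"

text \<open>One of the closed properties that \<open>blinfun_sqrt\<close> transfers to its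
  limit.\<close>

lemma closed_selfadjoint: "closed {T :: 'x \<Rightarrow>\<^sub>L 'x. selfadjoint (blinfun_apply T)}"
proof -
  have "{T :: 'x \<Rightarrow>\<^sub>L 'x. selfadjoint T} = (\<Inter>x. \<Inter>y. {T. ip (blinfun_apply T x) y = ip x (blinfun_apply T y)})"
    by (auto simp: selfadjoint_def)
  moreover have "closed {T :: 'x \<Rightarrow>\<^sub>L 'x. ip (blinfun_apply T x) y = ip x (blinfun_apply T y)}" for x y
    by (intro closed_Collect_eq bounded_linear.continuous_on[OF bounded_linear_ip_left]
        bounded_linear.continuous_on[OF bounded_linear_ip_right] continuous_intros)
  ultimately show ?thesis by (simp add: closed_INT)
qed

lemma norm_eq_if_ip_eq:
  assumes "\<And>x. ip (W x) (W x) = ip x x"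
  shows "norm (W x) = norm x"
  unfolding norm_ip assms ..

text \<open>Both \<open>S \<plusminus> \<i> V\<close> preserve the inner product, so \<open>V\<close> is a mean of two isometries.\<close>

lemma contraction_if_squares_sum_id:
  assumes S: "selfadjoint S" and V: "selfadjoint V"
    and comm: "\<And>x. S (V x) = V (S x)" and sum: "\<And>x. S (S x) + V (V x) = x"
  shows "norm (V x) \<le> norm x"
proof -
  have S': "ip (S x) y = ip x (S y)" and V': "ip (V x) y = ip x (V y)" for x y
    using S V by (auto simp: selfadjoint_def)
  have iso: "norm (V x + c *\<^sub>C S x) = norm x" if c: "c = \<i> \<or> c = -\<i>" for c x
  proof (rule norm_eq_if_ip_eq)
    fix x
    have cc: "cnj c = - c" "c * c = -1" using c by auto
    have m: "(- d) *\<^sub>C z = - (d *\<^sub>C z)" for d and z :: 'b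
      using scaleC_add_left[of d "-d" z] complex_vector.scale_zero_left[of z] 
      by (metis add.right_inverse minus_unique)
    \<comment> \<open>The cross terms cancel because \<open>S\<close> and \<open>V\<close> commute
      and \<open>cnj c = - c\<close>.\<close>
    have "ip (V x + c *\<^sub>C S x) (V x + c *\<^sub>C S x) = ip x (V (V x)) + ip x (S (S x))"
      by (simp add: ip_add_left ip_add_right ip_scaleC_left ip_scaleC_right scaleC_scaleC
          S' V' comm cc m scaleC_one scaleC_add_right complex_vector.scale_right_diff_distrib)
    also have "\<dots> = ip x x" using sum[of x] by (metis add.commute ip_add_right)
    finally show "ip (V x + c *\<^sub>C S x) (V x + c *\<^sub>C S x) = ip x x" .
  qed
  have "(V x + \<i> *\<^sub>C S x) + (V x + (-\<i>) *\<^sub>C S x) = 2 *\<^sub>R V x"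
    using scaleC_add_left[of "\<i>" "-\<i>" "S x"] by (simp add: scaleR_2)
  then have "2 * norm (V x) = norm ((V x + \<i> *\<^sub>C S x) + (V x + (-\<i>) *\<^sub>C S x))" by simp
  also have "\<dots> \<le> norm x + norm x"
    by (rule norm_triangle_mono) (simp_all only: iso simp_thms order_refl)
  finally show ?thesis by simp
qed

text \<open>Take \<open>U = S\<^sup>2\<close> in \<open>blinfun_sqrt\<close>. The contraction
  \<open>Z\<close> is kept in the conclusion because the form \<open>1 - Z\<close> later certifies
  positivity of \<open>V\<close>. The commutation clause makes \<open>S\<close> and \<open>V\<close>
  commute, whence \<open>V\<close> is a contraction and the construction can be repeated on
  it.\<close>

lemma sqrt_id_minus_square:
  fixes S :: "'x \<Rightarrow>\<^sub>L 'x"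
  assumes S: "selfadjoint S" and "norm S \<le> 1"
  shows "\<exists>V Z :: 'x \<Rightarrow>\<^sub>L 'x. V = id_blinfun - Z \<and> norm Z \<le> 1 \<and> selfadjoint (blinfun_apply Z) \<and>
    selfadjoint (blinfun_apply V) \<and> norm V \<le> 1 \<and> (\<forall>x. V (V x) = x - S (S x)) \<and>
    (\<forall>D :: 'x \<Rightarrow>\<^sub>L 'x. (\<forall>x. D (S x) = S (D x)) \<longrightarrow> (\<forall>x. D (V x) = V (D x)))"
proof -
  have "norm (S o\<^sub>L S) \<le> 1"
    using norm_blinfun_compose[of S S] mult_le_one[OF assms(2) norm_ge_zero assms(2)] by linarith
  then obtain Z where Z: "norm Z \<le> 1" "2 *\<^sub>R Z = (S o\<^sub>L S) + (Z o\<^sub>L Z)"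
    and ZC: "\<forall>C. closed C \<longrightarrow> 0 \<in> C \<longrightarrow>
        (\<forall>Y\<in>C. (1/2) *\<^sub>R ((S o\<^sub>L S) + (Y o\<^sub>L Y)) \<in> C) \<longrightarrow> Z \<in> C"
    by (rule blinfun_sqrt)
  have ip0: "ip 0 y = 0" "ip y 0 = 0" for y
    using ip_scaleR_left[of 0 0 y] ip_scaleR_right[of y 0 0] by auto
  have "Z \<in> {T. selfadjoint (blinfun_apply T)}"
    by (rule ZC[rule_format, OF closed_selfadjoint])
       (use S in \<open>auto simp: selfadjoint_def ip0 ip_add_left ip_add_right ip_scaleR_left ip_scaleR_right
         plus_blinfun.rep_eq scaleR_blinfun.rep_eq\<close>)
  then have saZ: "selfadjoint Z" by simp
  have ZZ: "2 *\<^sub>R Z x = S (S x) + Z (Z x)" for x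
    using arg_cong[OF Z(2), of "\<lambda>T. blinfun_apply T x"]
    by (simp add: plus_blinfun.rep_eq scaleR_blinfun.rep_eq)
  have Zcomm: "D (Z x) = Z (D x)" if D: "\<And>x. D (S x) = S (D x)" for D :: "'x \<Rightarrow>\<^sub>L 'x" and x
  proof -
    have "Z \<in> {T. D o\<^sub>L T = T o\<^sub>L D}"
    proof (rule ZC[rule_format])
      show "closed {T. D o\<^sub>L T = T o\<^sub>L D}" by (intro closed_Collect_eq continuous_intros)
      show "0 \<in> {T. D o\<^sub>L T = T o\<^sub>L D}" by (auto intro: blinfun_eqI simp: blinfun.zero_right)
      fix Y assume "Y \<in> {T. D o\<^sub>L T = T o\<^sub>L D}"
      then have "D o\<^sub>L Y = Y o\<^sub>L D" by simp
      from arg_cong[OF this, of "\<lambda>T. blinfun_apply T x" for x]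
      have "D (Y x) = Y (D x)" for x by simp
      then show "(1/2) *\<^sub>R ((S o\<^sub>L S) + (Y o\<^sub>L Y)) \<in> {T. D o\<^sub>L T = T o\<^sub>L D}"
        by (auto intro!: blinfun_eqI simp: plus_blinfun.rep_eq scaleR_blinfun.rep_eq
            blinfun.add_right blinfun.scaleR_right D)
    qed
    then have "D o\<^sub>L Z = Z o\<^sub>L D" by simp
    from arg_cong[OF this, of "\<lambda>T. blinfun_apply T x"] show ?thesis by simp
  qed
  define V where "V = id_blinfun - Z"
  have Vx: "V x = x - Z x" for x by (simp add: V_def minus_blinfun.rep_eq)
  have saV: "selfadjoint V"
    using saZ by (simp add: selfadjoint_def Vx ip_diff_left ip_diff_right)
  have VV: "V (V x) = x - S (S x)" for x
    using ZZ[of x] by (simp add: Vx blinfun.diff_right algebra_simps scaleR_2)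
  have Vcomm: "D (V x) = V (D x)" if "\<And>x. D (S x) = S (D x)" for D :: "'x \<Rightarrow>\<^sub>L 'x" and x
    by (simp add: Vx blinfun.diff_right Zcomm[OF that])
  have "S (V x) = V (S x)" for x by (rule Vcomm) simp
  then have "norm (V x) \<le> norm x" for x
    by (rule contraction_if_squares_sum_id[OF S saV]) (simp add: VV)
  then have "norm V \<le> 1" by (intro norm_blinfun_bound) simp_all
  then show ?thesis using V_def Z(1) saZ saV VV Vcomm by blast
qed

text \<open>Two square roots in succession: \<open>V\<close> is the root of
  \<open>1 - T\<^sup>2\<close> and \<open>B\<close> that of \<open>1 - V\<^sup>2\<close>, which
  equals \<open>T\<^sup>2\<close>.\<close>

lemma absolute_value:
  fixes T :: "'x \<Rightarrow>\<^sub>L 'x"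
  assumes "selfadjoint T" "norm T \<le> 1"
  shows "\<exists>B Z :: 'x \<Rightarrow>\<^sub>L 'x. B = id_blinfun - Z \<and> norm Z \<le> 1 \<and> selfadjoint (blinfun_apply Z) \<and>
    selfadjoint (blinfun_apply B) \<and> (\<forall>x. B (B x) = T (T x)) \<and> (\<forall>x. T (B x) = B (T x))"
proof -
  obtain V :: "'x \<Rightarrow>\<^sub>L 'x" where V: "selfadjoint (blinfun_apply V)" "norm V \<le> 1"
      "\<forall>x. V (V x) = x - T (T x)"
      "\<forall>D :: 'x \<Rightarrow>\<^sub>L 'x. (\<forall>x. D (T x) = T (D x)) \<longrightarrow> (\<forall>x. D (V x) = V (D x))"
    using sqrt_id_minus_square[OF assms] by (elim exE conjE)
  obtain B Z :: "'x \<Rightarrow>\<^sub>L 'x" where B: "B = id_blinfun - Z" "norm Z \<le> 1" "selfadjoint (blinfun_apply Z)"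
      "selfadjoint (blinfun_apply B)" "\<forall>x. B (B x) = x - V (V x)"
      "\<forall>D :: 'x \<Rightarrow>\<^sub>L 'x. (\<forall>x. D (V x) = V (D x)) \<longrightarrow> (\<forall>x. D (B x) = B (D x))"
    using sqrt_id_minus_square[OF V(1,2)] by (elim exE conjE)
  have "\<forall>x. T (V x) = V (T x)" using V(4) by simp
  then have "\<forall>x. T (B x) = B (T x)" using B(6) by simp
  moreover have "\<forall>x. B (B x) = T (T x)" using B(5) V(3) by simp
  ultimately show ?thesis using B by blast
qed

section \<open>Projections onto complemented submodules\<close>

definition projection_onto :: "'x set \<Rightarrow> ('x \<Rightarrow> 'x) \<Rightarrow> bool" where
  "projection_onto M p \<longleftrightarrow>
    bounded_linear p \<and> selfadjoint p \<and> (\<forall>x. p x \<in> M \<and> x - p x \<in> module_perp ip M)"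

text \<open>The decomposition along \<open>M\<close> is unique, since an element of \<open>M\<close>
  orthogonal to itself vanishes. Linearity and idempotence follow from uniqueness, self-adjointness
  from orthogonality of the two parts.\<close>

lemma ex_projection_onto:
  assumes "complemented_submodule act ip M"
  shows "\<exists>p. projection_onto M p"
proof -
  have subM: "complex_vector.subspace M"
    and dec: "\<forall>x. \<exists>y\<in>M. \<exists>z\<in>module_perp ip M. x = y + z"
    using assms by (auto simp: complemented_submodule_def closed_submodule_def)
  have "\<exists>y\<in>M. x - y \<in> module_perp ip M" for x
    using dec by (metis add_diff_cancel_left')
  then obtain p where pM: "\<And>x. p x \<in> M" and pP: "\<And>x. x - p x \<in> module_perp ip M" by metis
  have orth1: "ip z y = 0" if "z \<in> module_perp ip M" "y \<in> M" for y z
    using that by (auto simp: module_perp_def)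
  have orth2: "ip y z = 0" if "z \<in> module_perp ip M" "y \<in> M" for y z
    using orth1[OF that] ip_adj[of z y] adj_add[of 0 "0::'b"] by simp
  have uniq: "p x = y" if y: "y \<in> M" "x - y \<in> module_perp ip M" for x y
  proof -
    have "p x - y \<in> M" using pM y subM complex_vector.subspace_diff by blast
    then have "ip (x - y) (p x - y) = 0" "ip (x - p x) (p x - y) = 0" using orth1 y pP by auto
    then have "ip (p x - y) (p x - y) = 0" by (simp add: ip_diff_left)
    then show ?thesis using ip_eq_0D by force
  qed
  have add: "p (x + y) = p x + p y" for x y
  proof (rule uniq)
    show "p x + p y \<in> M" using pM subM complex_vector.subspace_add by blast
    have eq: "(x + y) - (p x + p y) = (x - p x) + (y - p y)" by simp
    show "(x + y) - (p x + p y) \<in> module_perp ip M"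
      unfolding eq using pP[of x] pP[of y] by (simp add: module_perp_def ip_add_left)
  qed
  have scale: "p (r *\<^sub>R x) = r *\<^sub>R p x" for r x
  proof (rule uniq)
    show "r *\<^sub>R p x \<in> M" using pM subspace_scale[OF complex_subspace_imp_subspace[OF subM]] by blast
    have "r *\<^sub>R x - r *\<^sub>R p x = r *\<^sub>R (x - p x)" by (simp add: scaleR_diff_right)
    then show "r *\<^sub>R x - r *\<^sub>R p x \<in> module_perp ip M"
      using pP[of x] by (simp add: module_perp_def ip_scaleR_left)
  qed
  have sa: "ip (p x) y = ip x (p y)" for x y
  proof -
    have "ip (p x) (y - p y) = 0" "ip (x - p x) (p y) = 0" using orth1 orth2 pM pP by auto
    then show ?thesis by (simp add: ip_diff_left ip_diff_right)
  qed
  have idem: "p (p x) = p x" for x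
    by (rule uniq) (use pM in \<open>auto simp: module_perp_def ip_scaleR_left[of 0 0, simplified]\<close>)
  \<comment> \<open>\<open>p\<close> is contractive as the mean of the identity and the isometric reflection \<open>2 p - 1\<close>.\<close>
  have "norm (2 *\<^sub>R p x - x) = norm x" for x
    by (rule norm_eq_if_ip_eq)
       (use scaleR_add_left[of 2 2 "ip x (p x)" for x] scaleR_2[of "ip x (p x)" for x] in
         \<open>simp add: ip_diff_left ip_diff_right ip_scaleR_left ip_scaleR_right sa idem\<close>)
  then have "norm (p x) \<le> norm x" for x
    using norm_triangle_ineq[of "2 *\<^sub>R p x - x" x] by simp
  then have "bounded_linear p"
    by (intro bounded_linear_intro[of _ 1]) (auto simp: add scale)
  then have "projection_onto M p" using sa pM pP by (simp add: projection_onto_def selfadjoint_def)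
  then show ?thesis by blast
qed

lemma selfadjoint_friedrichs_op:
  assumes "selfadjoint p" "selfadjoint q"
  shows "selfadjoint (friedrichs_op s p q)"
proof -
  define a b where "a x = q (p (q x))" and "b x = x - a x" for x
  have A: "ip (a x) y = ip x (a y)" for x y
    using assms by (simp add: selfadjoint_def a_def)
  have B: "ip (b x) y = ip x (b y)" for x y
    by (simp add: b_def ip_diff_left ip_diff_right A)
  have F: "friedrichs_op s p q x = b (s\<^sup>2 *\<^sub>R b x - a (b x))" for x
    by (simp add: friedrichs_op_def Let_def a_def b_def)
  have "ip (b (s\<^sup>2 *\<^sub>R b x - a (b x))) y = ip (b x) (s\<^sup>2 *\<^sub>R b y - a (b y))" for x y
    unfolding B[of _ y] by (simp add: ip_diff_left ip_diff_right ip_scaleR_left ip_scaleR_right A)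
  then show ?thesis unfolding selfadjoint_def F B[symmetric, of _ "s\<^sup>2 *\<^sub>R _ - _"] by blast
qed

end

section \<open>Operators on the module acting on its localization\<close>

locale localized_module = hilbert_module act ip
  for act :: "'x::complex_banach \<Rightarrow> 'b::cstar_algebra \<Rightarrow> 'x" and ip +
  fixes \<pi> :: "'b \<Rightarrow> 'h::complex_hilbert \<Rightarrow> 'h" and \<tau> :: "'x \<Rightarrow> 'h \<Rightarrow> 'k::complex_hilbert"
  assumes representation: "representation \<pi>"
    and tensor_product: "interior_tensor_product act ip \<pi> \<tau>"
begin

lemma tau_add_left: "\<tau> (x + y) h = \<tau> x h + \<tau> y h"
  and tau_scaleC_left: "\<tau> (c *\<^sub>C x) h = c *\<^sub>C \<tau> x h"
  and cinner_tau: "cinner (\<tau> x h) (\<tau> y k) = cinner h (\<pi> (ip x y) k)"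
  and dense_tau: "closure (complex_vector.span {\<tau> x h | x h. True}) = UNIV"
  using tensor_product unfolding interior_tensor_product_def by blast+

lemma tau_scaleR_left: "\<tau> (r *\<^sub>R x) h = r *\<^sub>R \<tau> x h"
  by (simp add: scaleR_scaleC tau_scaleC_left)

lemma tau_diff_left: "\<tau> (x - y) h = \<tau> x h - \<tau> y h"
  using tau_add_left[of x "- y" h] tau_scaleR_left[of "-1" y h] by simp

lemma pi_zero: "\<pi> 0 h = 0"
proof -
  have "\<pi> (0 + 0) h = \<pi> 0 h + \<pi> 0 h"
    using representation unfolding representation_def by blast
  then show ?thesis by simp
qed

text \<open>A list \<open>L\<close> of pairs stands for the element \<open>\<Sum> x \<otimes> h\<close> of the algebraic tensor product,
  and \<open>tensor T L\<close> is the image of that element under \<open>T \<otimes> 1\<close>.  Working with lists makes it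
  unnecessary to show that \<open>T \<otimes> 1\<close> is well-defined and bounded.\<close>

definition tensor :: "('x \<Rightarrow> 'x) \<Rightarrow> ('x \<times> 'h) list \<Rightarrow> 'k" where
  "tensor T L = (\<Sum>(x, h)\<leftarrow>L. \<tau> (T x) h)"

lemma tensor_Nil: "tensor T [] = 0"
  and tensor_Cons: "tensor T ((x, h) # L) = \<tau> (T x) h + tensor T L"
  by (simp_all add: tensor_def)

lemma tensor_append: "tensor T (L @ L') = tensor T L + tensor T L'"
  by (simp add: tensor_def)

lemma tensor_map: "tensor T (map (\<lambda>(x, h). (S x, h)) L) = tensor (\<lambda>x. T (S x)) L"
  by (induction L) (auto simp: tensor_Nil tensor_Cons)

lemma tensor_add: "tensor (\<lambda>x. S x + T x) L = tensor S L + tensor T L"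
  by (induction L) (auto simp: tensor_Nil tensor_Cons tau_add_left)

lemma tensor_diff: "tensor (\<lambda>x. S x - T x) L = tensor S L - tensor T L"
  by (induction L) (auto simp: tensor_Nil tensor_Cons tau_diff_left)

lemma tensor_scaleR: "tensor (\<lambda>x. r *\<^sub>R T x) L = r *\<^sub>R tensor T L"
  by (induction L) (auto simp: tensor_Nil tensor_Cons tau_scaleR_left scaleR_add_right)

lemma tensor_zero: "tensor (\<lambda>x. 0) L = 0"
  using tensor_scaleR[of 0 "\<lambda>x. 0" L] by simp

text \<open>Inner products of elementary tensors depend on the module only through
  \<open>ip\<close>. The maps \<open>S\<close> and \<open>U\<close> allow the outermost factor of a
  composite to be moved across.\<close>

lemma tensor_selfadjoint:
  assumes "selfadjoint T"
  shows "inner (tensor (\<lambda>x. T (S x)) L) (tensor U L') = inner (tensor S L) (tensor (\<lambda>x. T (U x)) L')"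
proof -
  have *: "inner (\<tau> (T x) h) (\<tau> y k) = inner (\<tau> x h) (\<tau> (T y) k)" for x h y k
    using assms by (simp add: cinner_tau selfadjoint_def flip: Re_cinner)
  have "inner (\<tau> (T x) h) (tensor U L') = inner (\<tau> x h) (tensor (\<lambda>x. T (U x)) L')" for x h
    by (induction L') (auto simp: tensor_Nil tensor_Cons inner_add_right *)
  then show ?thesis
    by (induction L) (auto simp: tensor_Nil tensor_Cons inner_add_left)
qed

text \<open>Scalars are absorbed into the module factor, so finite sums already form the complex
  span; closed conditions can thus be checked on lists.\<close>

lemma span_eq_range_tensor:
  "complex_vector.span {\<tau> x h | x h. True} = range (tensor (\<lambda>x. x))"
proof
  have "complex_vector.subspace (range (tensor (\<lambda>x. x)))"
    unfolding complex_vector.subspace_def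
  proof (intro conjI ballI allI)
    show "0 \<in> range (tensor (\<lambda>x. x))" using tensor_Nil by (metis rangeI)
    show "a + b \<in> range (tensor (\<lambda>x. x))"
      if "a \<in> range (tensor (\<lambda>x. x))" "b \<in> range (tensor (\<lambda>x. x))" for a b
      using that by (auto simp flip: tensor_append)
    show "c *\<^sub>C a \<in> range (tensor (\<lambda>x. x))" if a: "a \<in> range (tensor (\<lambda>x. x))" for c a
    proof -
      have "c *\<^sub>C tensor (\<lambda>x. x) L = tensor (\<lambda>x. c *\<^sub>C x) L" for L
        by (induction L)
           (auto simp: tensor_Nil tensor_Cons scaleC_add_right tau_scaleC_left
             complex_vector.scale_zero_right)
      then have "c *\<^sub>C tensor (\<lambda>x. x) L = tensor (\<lambda>x. x) (map (\<lambda>(x, h). (c *\<^sub>C x, h)) L)" for L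
        by (simp only: tensor_map)
      then show ?thesis using a by auto
    qed
  qed
  moreover have "{\<tau> x h | x h. True} \<subseteq> range (tensor (\<lambda>x. x))"
  proof clarify
    fix x h
    have "\<tau> x h = tensor (\<lambda>x. x) [(x, h)]" by (simp add: tensor_Nil tensor_Cons)
    then show "\<tau> x h \<in> range (tensor (\<lambda>x. x))" by blast
  qed
  ultimately show "complex_vector.span {\<tau> x h | x h. True} \<subseteq> range (tensor (\<lambda>x. x))"
    by (intro complex_vector.span_minimal)
  have tau: "\<tau> x h \<in> complex_vector.span {\<tau> x h | x h. True}" for x h
    by (intro complex_vector.span_base) blast
  have "tensor (\<lambda>x. x) L \<in> complex_vector.span {\<tau> x h | x h. True}" for L
  proof (induction L)
    case (Cons a L)
    then show ?case by (cases a) (simp only: tensor_Cons complex_vector.span_add tau)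
  qed (simp only: tensor_Nil complex_vector.span_zero)
  then show "range (tensor (\<lambda>x. x)) \<subseteq> complex_vector.span {\<tau> x h | x h. True}" by blast
qed

lemma dense_tensor: "closure (range (tensor (\<lambda>x. x))) = UNIV"
  using dense_tau unfolding span_eq_range_tensor .

text \<open>Positivity of \<open>T \<otimes> 1\<close>, tested on the dense set of algebraic
  tensors.\<close>

definition tensor_nonneg :: "('x \<Rightarrow> 'x) \<Rightarrow> bool" where
  "tensor_nonneg T \<longleftrightarrow> (\<forall>L. 0 \<le> inner (tensor (\<lambda>x. x) L) (tensor T L))"

lemma tensor_nonnegD:
  assumes "tensor_nonneg T"
  shows "0 \<le> inner (tensor S L) (tensor (\<lambda>x. T (S x)) L)"
  using assms[unfolded tensor_nonneg_def, rule_format, of "map (\<lambda>(x, h). (S x, h)) L"]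
  unfolding tensor_map .

text \<open>With \<open>V\<close> the square root of \<open>1 - S\<^sup>2\<close>, the difference of
  the squared norms is the squared norm of \<open>tensor V L\<close>.\<close>

lemma norm_tensor_le:
  fixes S :: "'x \<Rightarrow>\<^sub>L 'x"
  assumes "selfadjoint S" "norm S \<le> 1"
  shows "norm (tensor S L) \<le> norm (tensor (\<lambda>x. x) L)"
proof -
  obtain V :: "'x \<Rightarrow>\<^sub>L 'x" where V: "selfadjoint (blinfun_apply V)" "\<forall>x. V (V x) = x - S (S x)"
    using sqrt_id_minus_square[OF assms] by (elim exE conjE)
  have "0 \<le> inner (tensor V L) (tensor V L)" by simp
  also have "\<dots> = inner (tensor (\<lambda>x. x) L) (tensor (\<lambda>x. x - S (S x)) L)"
    using tensor_selfadjoint[OF V(1), of "\<lambda>x. x" L V L] by (simp add: V(2))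
  also have "\<dots> = (norm (tensor (\<lambda>x. x) L))\<^sup>2 - (norm (tensor S L))\<^sup>2"
    using tensor_selfadjoint[OF assms(1), of "\<lambda>x. x" L S L]
    by (simp add: tensor_diff inner_diff_right power2_norm_eq_inner)
  finally show ?thesis by (intro power2_le_imp_le[OF _ norm_ge_zero]) simp
qed

lemma tensor_nonneg_id_minus:
  fixes Z :: "'x \<Rightarrow>\<^sub>L 'x"
  assumes "selfadjoint Z" "norm Z \<le> 1"
  shows "tensor_nonneg (\<lambda>x. x - Z x)"
  unfolding tensor_nonneg_def
proof
  fix L
  have "inner (tensor (\<lambda>x. x) L) (tensor Z L) \<le> norm (tensor (\<lambda>x. x) L) * norm (tensor Z L)"
    by (rule norm_cauchy_schwarz)
  also have "\<dots> \<le> norm (tensor (\<lambda>x. x) L) * norm (tensor (\<lambda>x. x) L)"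
    using norm_tensor_le[OF assms] by (intro mult_left_mono) auto
  finally show "0 \<le> inner (tensor (\<lambda>x. x) L) (tensor (\<lambda>x. x - Z x) L)"
    by (simp add: tensor_diff inner_diff_right flip: power2_norm_eq_inner power2_eq_square)
qed

text \<open>If \<open>T \<otimes> 1\<close> is nonnegative then it agrees with \<open>\<bar>T\<bar> \<otimes> 1\<close>, and injectivity of the
  representation gives \<open>T = \<bar>T\<bar>\<close>, a condition that does not involve the representation.\<close>

lemma nonneg_imp_eq_absolute_value:
  fixes T :: "'x \<Rightarrow>\<^sub>L 'x"
  assumes inj: "inj \<pi>" and T: "selfadjoint T" "norm T \<le> 1" and pos: "tensor_nonneg T"
  shows "\<exists>Z :: 'x \<Rightarrow>\<^sub>L 'x. norm Z \<le> 1 \<and> selfadjoint (blinfun_apply Z) \<and> (\<forall>x. T x = x - Z x)"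
proof -
  obtain B Z :: "'x \<Rightarrow>\<^sub>L 'x" where B_def: "B = id_blinfun - Z"
    and Z: "norm Z \<le> 1" "selfadjoint (blinfun_apply Z)"
    and B: "selfadjoint (blinfun_apply B)" "\<forall>x. B (B x) = T (T x)" "\<forall>x. T (B x) = B (T x)"
    using absolute_value[OF T] by (elim exE conjE)
  have Bx: "B x = x - Z x" for x by (simp add: B_def minus_blinfun.rep_eq)
  then have "blinfun_apply B = (\<lambda>x. x - Z x)" by blast
  then have posB: "tensor_nonneg B" using tensor_nonneg_id_minus[OF Z(2,1)] by simp
  define g where "g x = B x - T x" for x
  have sag: "selfadjoint g"
    using T(1) B(1) by (simp add: selfadjoint_def g_def ip_diff_left ip_diff_right)
  \<comment> \<open>Since \<open>B\<close> and \<open>T\<close> commute and have equal squares,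
    \<open>(B + T) g = 0\<close>. The two nonnegative forms therefore sum to zero, so both
    vanish.\<close>
  have ggg: "inner (tensor (\<lambda>x. g (S x)) L) (tensor (\<lambda>x. g (g (S x))) L) = 0" for S L
  proof -
    let ?G = "tensor (\<lambda>x. g (S x)) L"
    let ?B = "tensor (\<lambda>x. B (g (S x))) L" and ?T = "tensor (\<lambda>x. T (g (S x))) L"
    have "B (g x) + T (g x) = 0" for x
      by (simp add: g_def blinfun.diff_right B(2,3))
    then have "?B + ?T = 0" by (simp add: tensor_zero flip: tensor_add)
    then have "inner ?G ?B + inner ?G ?T = 0" by (simp flip: inner_add_right)
    moreover have "0 \<le> inner ?G ?B" "0 \<le> inner ?G ?T"
      using tensor_nonnegD[OF posB, of "\<lambda>x. g (S x)"] tensor_nonnegD[OF pos, of "\<lambda>x. g (S x)"] by auto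
    ultimately have "inner ?G (?B - ?T) = 0" by (simp add: inner_diff_right)
    then show ?thesis by (simp add: g_def[of "g (S _)"] tensor_diff)
  qed
  have gadd: "g (x + y) = g x + g y" for x y by (simp add: g_def blinfun.add_right)
  \<comment> \<open>Polarization: taking \<open>1 + g\<close> for \<open>S\<close> in
    \<open>ggg\<close> and removing the diagonal terms leaves twice the squared norm of
    \<open>?t2\<close>.\<close>
  have gg: "tensor (\<lambda>x. g (g x)) L = 0" for L
  proof -
    let ?t1 = "tensor g L" and ?t2 = "tensor (\<lambda>x. g (g x)) L" and ?t3 = "tensor (\<lambda>x. g (g (g x))) L"
    have "inner (?t1 + ?t2) (?t2 + ?t3) = 0"
      using ggg[of "\<lambda>x. x + g x" L] by (simp add: gadd tensor_add)
    moreover have "inner ?t1 ?t2 = 0" using ggg[of "\<lambda>x. x" L] by simp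
    moreover have "inner ?t2 ?t3 = 0" using ggg[of g L] by simp
    moreover have "inner ?t1 ?t3 = inner ?t2 ?t2"
      using tensor_selfadjoint[OF sag, of g L "\<lambda>x. g (g x)" L] by simp
    ultimately have "2 * inner ?t2 ?t2 = 0" by (simp add: inner_add_left inner_add_right)
    then show ?thesis by simp
  qed
  have tg: "tensor g L = 0" for L
    using tensor_selfadjoint[OF sag, of "\<lambda>x. x" L g L] gg[of L] by simp
  \<comment> \<open>A vanishing localization puts \<open>ip (g y) (g y)\<close> into the kernel of
    \<open>\<pi>\<close>, which is trivial; then \<open>ip\<close> being definite gives the
    claim.\<close>
  have "g y = 0" for y
  proof -
    have "\<pi> (ip (g y) (g y)) k = 0" for k
    proof -
      have "\<tau> (g y) k = 0" using tg[of "[(y, k)]"] by (simp add: tensor_Nil tensor_Cons)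
      then have "cinner (\<tau> (g y) h) (\<tau> (g y) k) = 0" for h
        using cinner_scaleC_right[of _ 0 0] complex_vector.scale_zero_left[of "0::'k"] by simp
      then have "cinner h (\<pi> (ip (g y) (g y)) k) = 0" for h by (simp add: cinner_tau)
      from this[of "\<pi> (ip (g y) (g y)) k"] show ?thesis
        by (metis Re_cinner inner_eq_zero_iff zero_complex.sel(1))
    qed
    then have "\<pi> (ip (g y) (g y)) = \<pi> 0" by (auto simp: pi_zero)
    then show ?thesis using inj ip_eq_0D by (metis injD)
  qed
  then have "T x = x - Z x" for x using Bx[of x] by (simp add: g_def)
  then show ?thesis using Z by blast
qed

text \<open>Scaling by \<open>norm T + 1\<close>, which is positive even for \<open>T = 0\<close>,
  reduces to contractions. The right-hand side mentions neither \<open>\<pi>\<close> nor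
  \<open>\<tau>\<close>, so positivity passes between faithful representations.\<close>

lemma tensor_nonneg_iff:
  fixes T :: "'x \<Rightarrow>\<^sub>L 'x"
  assumes inj: "inj \<pi>" and T: "selfadjoint T"
  shows "tensor_nonneg T \<longleftrightarrow>
    (\<exists>Z :: 'x \<Rightarrow>\<^sub>L 'x. norm Z \<le> 1 \<and> selfadjoint (blinfun_apply Z) \<and> (\<forall>x. T x = (norm T + 1) *\<^sub>R (x - Z x)))"
proof
  define r where "r = norm T + 1"
  have r: "r > 0" by (simp add: r_def add_nonneg_pos)
  assume pos: "tensor_nonneg T"
  define T' where "T' = (1 / r) *\<^sub>R T"
  have T'x: "blinfun_apply T' = (\<lambda>x. (1 / r) *\<^sub>R T x)" by (simp add: T'_def scaleR_blinfun.rep_eq)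
  have "selfadjoint T'"
    using T by (simp add: selfadjoint_def T'x ip_scaleR_left ip_scaleR_right)
  moreover have "norm T' \<le> 1" using r by (simp add: T'_def r_def)
  moreover have "tensor_nonneg T'"
    using pos r by (simp add: tensor_nonneg_def T'x tensor_scaleR)
  ultimately obtain Z :: "'x \<Rightarrow>\<^sub>L 'x"
    where "norm Z \<le> 1" "selfadjoint (blinfun_apply Z)" and Z: "\<forall>x. T' x = x - Z x"
    using nonneg_imp_eq_absolute_value[OF inj] by blast
  moreover have "T x = r *\<^sub>R (x - Z x)" for x
  proof -
    have "x - Z x = (1 / r) *\<^sub>R T x" using Z T'x by simp
    then show ?thesis using r by simp
  qed
  ultimately show "\<exists>Z :: 'x \<Rightarrow>\<^sub>L 'x. norm Z \<le> 1 \<and> selfadjoint (blinfun_apply Z) \<and> (\<forall>x. T x = (norm T + 1) *\<^sub>R (x - Z x))"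
    unfolding r_def by blast
next
  assume "\<exists>Z :: 'x \<Rightarrow>\<^sub>L 'x. norm Z \<le> 1 \<and> selfadjoint (blinfun_apply Z) \<and> (\<forall>x. T x = (norm T + 1) *\<^sub>R (x - Z x))"
  then obtain Z :: "'x \<Rightarrow>\<^sub>L 'x"
    where Z: "norm Z \<le> 1" "selfadjoint (blinfun_apply Z)" "\<forall>x. T x = (norm T + 1) *\<^sub>R (x - Z x)" by blast
  have "tensor_nonneg (\<lambda>x. (norm T + 1) *\<^sub>R (x - Z x))"
    using tensor_nonneg_id_minus[OF Z(2,1)]
    by (auto simp: tensor_nonneg_def tensor_scaleR intro!: mult_nonneg_nonneg)
  moreover have "blinfun_apply T = (\<lambda>x. (norm T + 1) *\<^sub>R (x - Z x))"
    using Z(3) by (intro ext) (rule spec)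
  ultimately show "tensor_nonneg T" by simp
qed

section \<open>Localized submodules and their angle\<close>

lemma closed_complex_subspace_localized: "closed_complex_subspace (localized_submodule \<tau> M)"
  unfolding localized_submodule_def
  by unfold_locales (auto intro: complex_subspace_closure complex_vector.subspace_span)

lemma tau_in_localized: "x \<in> M \<Longrightarrow> \<tau> x h \<in> localized_submodule \<tau> M"
  unfolding localized_submodule_def
  by (intro subsetD[OF closure_subset] complex_vector.span_base) blast

text \<open>The complex form of the hypothesis extends orthogonality to the complex span; the real
  part is taken before passing to the closure.\<close>

lemma localized_orthogonal:
  assumes z: "\<And>x h. x \<in> M \<Longrightarrow> cinner z (\<tau> x h) = 0" and v: "v \<in> localized_submodule \<tau> M"
  shows "inner z v = 0"
proof -
  have "complex_vector.subspace {v. cinner z v = 0}"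
    using cinner_scaleC_right[of z 0 0] complex_vector.scale_zero_left[of 0]
    by (auto simp: complex_vector.subspace_def cinner_add_right cinner_scaleC_right)
  then have "complex_vector.span {\<tau> x h | x h. x \<in> M} \<subseteq> {v. cinner z v = 0}"
    using z by (intro complex_vector.span_minimal) auto
  then have "complex_vector.span {\<tau> x h | x h. x \<in> M} \<subseteq> {v. inner z v = 0}"
    by (auto simp flip: Re_cinner)
  moreover have "closed {v. inner z v = 0}" by (intro closed_Collect_eq continuous_intros)
  ultimately have "localized_submodule \<tau> M \<subseteq> {v. inner z v = 0}"
    unfolding localized_submodule_def by (rule closure_minimal)
  then show ?thesis using v by blast
qed

lemma localized_perp:
  assumes "v \<in> localized_submodule \<tau> M" "w \<in> localized_submodule \<tau> (module_perp ip M)"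
  shows "inner v w = 0"
proof (rule localized_orthogonal[OF _ assms(2)])
  fix x h assume x: "x \<in> module_perp ip M"
  interpret closed_complex_subspace "localized_submodule \<tau> M"
    by (rule closed_complex_subspace_localized)
  have "cinner (\<tau> x h) (\<tau> y k) = 0" if "y \<in> M" for y k
    using x that cinner_scaleC_right[of h 0 0] complex_vector.scale_zero_left[of "0::'h"]
    by (simp add: cinner_tau module_perp_def pi_zero)
  then have "\<forall>v\<in>localized_submodule \<tau> M. inner v (\<tau> x h) = 0"
    using localized_orthogonal[of M "\<tau> x h"] by (simp add: inner_commute)
  then show "cinner v (\<tau> x h) = 0"
    using assms(1) cinner_orthogonal_iff[OF csub] by blast
qed

lemma orth_proj_tau:
  assumes p: "projection_onto M p"
  shows "orth_proj (localized_submodule \<tau> M) (\<tau> x h) = \<tau> (p x) h"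
proof (rule closed_complex_subspace.orth_proj_unique[OF closed_complex_subspace_localized])
  show "\<tau> (p x) h \<in> localized_submodule \<tau> M" using p by (auto intro: tau_in_localized simp: projection_onto_def)
  show "inner v (\<tau> x h - \<tau> (p x) h) = 0" if "v \<in> localized_submodule \<tau> M" for v
  proof -
    have "\<tau> (x - p x) h \<in> localized_submodule \<tau> (module_perp ip M)"
      using p by (auto intro: tau_in_localized simp: projection_onto_def)
    from localized_perp[OF that this] show ?thesis by (simp add: tau_diff_left)
  qed
qed

lemma orth_proj_tensor:
  assumes p: "projection_onto M p"
  shows "tensor (\<lambda>x. p (S x)) L = orth_proj (localized_submodule \<tau> M) (tensor S L)"
proof -
  interpret closed_complex_subspace "localized_submodule \<tau> M"
    by (rule closed_complex_subspace_localized)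
  show ?thesis
    by (induction L)
       (auto simp: tensor_Nil tensor_Cons linear_0[OF linear_orth_proj]
         linear_add[OF linear_orth_proj] orth_proj_tau[OF p])
qed

text \<open>For the harder inclusion, \<open>1 - p\<close> maps algebraic tensors into the localized
  complement, where it acts as the projection complementary to that onto \<open>?V\<close>. Density
  and closedness extend this to all vectors.\<close>

lemma localized_perp_eq:
  assumes p: "projection_onto M p"
  shows "localized_submodule \<tau> (module_perp ip M) = orth_comp (localized_submodule \<tau> M)"
    (is "?V' = orth_comp ?V")
proof
  show "?V' \<subseteq> orth_comp ?V" by (auto simp: orth_comp_def localized_perp)
  interpret V: closed_complex_subspace ?V by (rule closed_complex_subspace_localized)
  interpret V': closed_complex_subspace ?V' by (rule closed_complex_subspace_localized)
  have "tensor (\<lambda>x. x) L - orth_proj ?V (tensor (\<lambda>x. x) L) \<in> ?V'" for L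
  proof -
    have "tensor (\<lambda>x. x - p x) L \<in> ?V'"
      using p by (induction L)
         (auto simp: tensor_Nil tensor_Cons subspace_0 V'.sub projection_onto_def
           intro!: subspace_add V'.sub tau_in_localized)
    then show ?thesis by (simp add: tensor_diff orth_proj_tensor[OF p, of "\<lambda>x. x"])
  qed
  then have "range (tensor (\<lambda>x. x)) \<subseteq> (\<lambda>z. z - orth_proj ?V z) -` ?V'" by auto
  moreover have "closed ((\<lambda>z. z - orth_proj ?V z) -` ?V')"
    by (intro closed_vimage V'.clo continuous_intros
        bounded_linear.continuous_on[OF V.bounded_linear_orth_proj])
  ultimately have "closure (range (tensor (\<lambda>x. x))) \<subseteq> (\<lambda>z. z - orth_proj ?V z) -` ?V'"
    by (rule closure_minimal)
  then have *: "z - orth_proj ?V z \<in> ?V'" for z by (auto simp: dense_tensor)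
  show "orth_comp ?V \<subseteq> ?V'"
  proof
    fix z assume "z \<in> orth_comp ?V"
    then have "orth_proj ?V z = 0" by (intro V.orth_proj_eq_0) (auto simp: orth_comp_def)
    then show "z \<in> ?V'" using *[of z] by simp
  qed
qed

lemma subspace_pair_localized: "subspace_pair (localized_submodule \<tau> M) (localized_submodule \<tau> N)"
  by (intro subspace_pair.intro closed_complex_subspace_localized)

lemma local_friedrichs_cos_nonneg: "0 \<le> local_friedrichs_cos \<tau> M N"
  unfolding local_friedrichs_cos_def
  by (intro onorm_pos_le subspace_pair.bounded_linear_friedrichs subspace_pair_localized)

lemma local_friedrichs_cos_le_iff:
  "0 \<le> s \<Longrightarrow> local_friedrichs_cos \<tau> M N \<le> s \<longleftrightarrow>
    friedrichs_le (localized_submodule \<tau> M) (localized_submodule \<tau> N) s"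
  unfolding local_friedrichs_cos_def
  by (rule subspace_pair.onorm_friedrichs_iff[OF subspace_pair_localized])

text \<open>\<open>p\<close> and \<open>q\<close> localize to the projections \<open>?P\<close> and
  \<open>?Q\<close>, so \<open>friedrichs_op s p q\<close> localizes to their Friedrichs operator,
  whose nonnegativity extends from a dense set by continuity.\<close>

lemma friedrichs_le_localized_iff:
  assumes p: "projection_onto M p"
    and q: "projection_onto N q"
    and s: "0 \<le> s"
  shows "friedrichs_le (localized_submodule \<tau> M) (localized_submodule \<tau> N) s \<longleftrightarrow>
    tensor_nonneg (friedrichs_op s p q)"
proof -
  let ?P = "orth_proj (localized_submodule \<tau> M)" and ?Q = "orth_proj (localized_submodule \<tau> N)"
  interpret subspace_pair "localized_submodule \<tau> M" "localized_submodule \<tau> N"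
    by (rule subspace_pair_localized)
  let ?G = "{z. 0 \<le> inner z (friedrichs_op s ?P ?Q z)}"
  have op: "tensor (friedrichs_op s p q) L = friedrichs_op s ?P ?Q (tensor (\<lambda>x. x) L)" for L
    by (simp add: friedrichs_op_def[abs_def] Let_def tensor_diff tensor_scaleR
        orth_proj_tensor[OF p] orth_proj_tensor[OF q])
  have "closed ?G" by (intro closed_Collect_le continuous_intros continuous_friedrichs_op)
  then have "?G = UNIV" if "range (tensor (\<lambda>x. x)) \<subseteq> ?G"
    using closure_minimal[OF that] by (simp add: dense_tensor top.extremum_unique)
  then have "?G = UNIV \<longleftrightarrow> range (tensor (\<lambda>x. x)) \<subseteq> ?G" by blast
  then show ?thesis
    unfolding friedrichs_le_iff_op_nonneg[OF s] tensor_nonneg_def op by blast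
qed

lemma local_friedrichs_cos_perp:
  assumes M: "complemented_submodule act ip M" and N: "complemented_submodule act ip N"
  shows "local_friedrichs_cos \<tau> (module_perp ip M) (module_perp ip N) = local_friedrichs_cos \<tau> M N"
proof -
  let ?V = "localized_submodule \<tau> M" and ?W = "localized_submodule \<tau> N"
  obtain p where p: "projection_onto M p"
    using ex_projection_onto[OF M] by blast
  obtain q where q: "projection_onto N q"
    using ex_projection_onto[OF N] by blast
  note eq = localized_perp_eq[OF p] localized_perp_eq[OF q]
  interpret VW: subspace_pair ?V ?W by (rule subspace_pair_localized)
  interpret VW': subspace_pair "orth_comp ?V" "orth_comp ?W"
    using subspace_pair_localized[of "module_perp ip M" "module_perp ip N"] unfolding eq .
  have "friedrichs_le (orth_comp ?V) (orth_comp ?W) s \<longleftrightarrow> friedrichs_le ?V ?W s" if s: "0 \<le> s" for s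
    using VW.friedrichs_le_orth_comp[OF _ s VW'.V.closed_complex_subspace_axioms]
      VW'.friedrichs_le_orth_comp[OF _ s]
    by (auto simp: VW.V.orth_comp_orth_comp VW.W.orth_comp_orth_comp VW.V.closed_complex_subspace_axioms)
  then have "local_friedrichs_cos \<tau> (module_perp ip M) (module_perp ip N) \<le> s \<longleftrightarrow>
      local_friedrichs_cos \<tau> M N \<le> s" if "0 \<le> s" for s
    using that by (simp add: local_friedrichs_cos_le_iff eq)
  \<comment> \<open>Each cosine is used as an upper bound for the other.\<close>
  from this[OF local_friedrichs_cos_nonneg[of M N]]
    this[OF local_friedrichs_cos_nonneg[of "module_perp ip M" "module_perp ip N"]]
  show ?thesis by simp
qed

end

section \<open>Independence of the faithful representation\<close>

text \<open>With \<open>s\<close> the cosine for \<open>\<sigma>\<close>, the bound becomes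
  positivity of one operator on the module, which \<open>tensor_nonneg_iff\<close> carries over to
  \<open>\<tau>\<close>. The reverse inequality follows by exchanging the representations.\<close>

lemma local_friedrichs_cos_le:
  fixes act :: "'x::complex_banach \<Rightarrow> 'b::cstar_algebra \<Rightarrow> 'x"
    and \<tau> :: "'x \<Rightarrow> 'h::complex_hilbert \<Rightarrow> 'k::complex_hilbert"
    and \<sigma> :: "'x \<Rightarrow> 'g::complex_hilbert \<Rightarrow> 'l::complex_hilbert"
  assumes "localized_module act ip \<pi> \<tau>" "inj \<pi>" "localized_module act ip \<rho> \<sigma>" "inj \<rho>"
    and M: "complemented_submodule act ip M" and N: "complemented_submodule act ip N"
  shows "local_friedrichs_cos \<tau> M N \<le> local_friedrichs_cos \<sigma> M N"
proof -
  interpret T: localized_module act ip \<pi> \<tau> by fact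
  interpret S: localized_module act ip \<rho> \<sigma> by fact
  obtain p where p: "T.projection_onto M p"
    using T.ex_projection_onto[OF M] by blast
  then have p': "bounded_linear p" "T.selfadjoint p" by (auto simp: T.projection_onto_def)
  obtain q where q: "T.projection_onto N q"
    using T.ex_projection_onto[OF N] by blast
  then have q': "bounded_linear q" "T.selfadjoint q" by (auto simp: T.projection_onto_def)
  define s where "s = local_friedrichs_cos \<sigma> M N"
  have s: "0 \<le> s" unfolding s_def by (rule S.local_friedrichs_cos_nonneg)
  define F where "F = Blinfun (friedrichs_op s p q)"
  have "bounded_linear (friedrichs_op s p q)"
    unfolding friedrichs_op_def Let_def
    by (intro bounded_linear_sub bounded_linear_compose[OF p'(1)] bounded_linear_compose[OF q'(1)]
        bounded_linear_const_scaleR bounded_linear_ident p'(1) q'(1))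
  then have F: "blinfun_apply F = friedrichs_op s p q"
    unfolding F_def by (rule bounded_linear_Blinfun_apply)
  have saF: "T.selfadjoint F" unfolding F by (rule T.selfadjoint_friedrichs_op[OF p'(2) q'(2)])
  have "friedrichs_le (localized_submodule \<sigma> M) (localized_submodule \<sigma> N) s"
    using S.local_friedrichs_cos_le_iff[OF s, of M N] by (simp add: s_def)
  then have "S.tensor_nonneg F"
    unfolding F using S.friedrichs_le_localized_iff[OF p q s] by simp
  then have "T.tensor_nonneg F"
    unfolding T.tensor_nonneg_iff[OF \<open>inj \<pi>\<close> saF] S.tensor_nonneg_iff[OF \<open>inj \<rho>\<close> saF] .
  then have "friedrichs_le (localized_submodule \<tau> M) (localized_submodule \<tau> N) s"
    unfolding F using T.friedrichs_le_localized_iff[OF p q s] by simp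
  then show ?thesis using T.local_friedrichs_cos_le_iff[OF s, of M N] by (simp add: s_def)
qed

theorem theorem3p4:
  fixes act :: "'x::complex_banach \<Rightarrow> 'b::cstar_algebra \<Rightarrow> 'x"
    and ip :: "'x \<Rightarrow> 'x \<Rightarrow> 'b"
    and M N :: "'x set"
    and \<pi> :: "'b \<Rightarrow> 'h::complex_hilbert \<Rightarrow> 'h"
    and \<rho> :: "'b \<Rightarrow> 'g::complex_hilbert \<Rightarrow> 'g"
    and \<tau> :: "'x \<Rightarrow> 'h \<Rightarrow> 'k::complex_hilbert"
    and \<sigma> :: "'x \<Rightarrow> 'g \<Rightarrow> 'l::complex_hilbert"
  assumes "hilbert_module act ip"
    and "complemented_submodule act ip M"
    and "complemented_submodule act ip N"
    and "faithful_representation \<pi>" and "interior_tensor_product act ip \<pi> \<tau>"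
    and "faithful_representation \<rho>" and "interior_tensor_product act ip \<rho> \<sigma>"
  shows "local_friedrichs_cos \<tau> M N = local_friedrichs_cos \<sigma> M N \<and>
    local_friedrichs_cos \<tau> M N =
      local_friedrichs_cos \<sigma> (module_perp ip M) (module_perp ip N)"
proof -
  have T: "localized_module act ip \<pi> \<tau>" "inj \<pi>" and S: "localized_module act ip \<rho> \<sigma>" "inj \<rho>"
    using assms
    by (auto simp: localized_module_def localized_module_axioms_def faithful_representation_def)
  have "local_friedrichs_cos \<tau> M N = local_friedrichs_cos \<sigma> M N"
    by (intro order_antisym local_friedrichs_cos_le[OF T S] local_friedrichs_cos_le[OF S T] assms)
  then show ?thesis
    using localized_module.local_friedrichs_cos_perp[OF S(1) assms(2,3)] by simp
qed

end
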